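(* Let $A=\Bbbk Q/I$ be a gentle algebra. Assume that $Q$ has no oriented cycles, no parallel arrows, and no subquivers of the form $(\star)$ (described in the context). Let $f=\sum_{i=1}^m f_it^i$ with $f_i\in B^1(A)[1]$. Then $f$ is a Maurer-Cartan element if and only if $f_i$ is a $2$-cocycle for all $i$.
   Context: Let $\Bbbk$ be a field of characteristic zero. $Q$ is a finite quiver with vertex set $Q_0$, arrow set $Q_1$ and source/target maps $s,t$. Paths are composed left to right: $\alpha_1\cdots\alpha_n$ is a path if $t(\alpha_i)=s(\alpha_{i+1})$. Two paths are parallel if they have the same starting point and the same ending point; "no parallel arrows" means no two distinct arrows are parallel. $A=\Bbbk Q/I$ is finite dimensional with $I$ admissible, and is called quadratic if $I$ is generated by paths of length two. The nonzero paths (paths not in $I$) form a basis of $A$; unless said otherwise products of paths are taken in $A$. The quadratic algebra $A$ is gentle if for every $\alpha\in Q_1$ there is at most one arrow $\beta$ with $s(\beta)=t(\alpha)$ and $\alpha\beta\in I$, at most one arrow $\gamma$ with $t(\gamma)=s(\alpha)$ and $\gamma\alpha\in I$, at most one arrow $\beta$ with $s(\beta)=t(\alpha)$ and $\alpha\beta\notin I$, and at most one arrow $\gamma$ with $t(\gamma)=s(\alpha)$ and $\gamma\alpha\notin I$. $AP_n$ is the set of tuples of arrows $(\alpha_1,\ldots,\alpha_n)$ with $t(\alpha_i)=s(\alpha_{i+1})$ and $\alpha_i\alpha_{i+1}=0$ in $A$ for every $i$; $E=\Bbbk Q_0$. $B^1(A)[1]=\operatorname{Hom}_{E-E}(\Bbbk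 AP_2,A)$, i.e. linear maps sending each $(\alpha,\beta)\in AP_2$ to a combination of nonzero paths parallel to $\alpha\beta$; write $f(\alpha\beta)$ for $f(\alpha,\beta)$. For $f\in B^1(A)[1]$, $\delta^2(f):\Bbbk AP_3\to A$ is given by $\delta^2(f)(\alpha_1,\alpha_2,\alpha_3)=\alpha_1f(\alpha_2\alpha_3)-f(\alpha_1\alpha_2)\alpha_3$, and $f$ is a $2$-cocycle if $\delta^2(f)=0$. The brackets $l_n$ (restriction to degree-one elements of the $L_\infty$-structure on the shifted Bardzell complex). For $f_1,\ldots,f_n\in B^1(A)[1]$ define recursively $\phi_n(f_1,\ldots,f_n)(u\otimes v)\in A$ and $v_n(f_1,\ldots,f_n)(a\otimes b\otimes c)\in A$ for composable nonzero paths (extended multilinearly, and zero if a tensor factor is a vertex or the factors are not composable). Put $v_1=0$. For $u=\beta_1\cdots\beta_m$, $v=\gamma_1\cdots\gamma_r$ with arrows $\beta_i,\gamma_j$: $\phi_1(f)(u\otimes v)=\beta_1\cdots\beta_{m-1}f(\beta_m\gamma_1)\gamma_2\cdots\gamma_r$ if $\beta_m\gamma_1=0$, and $0$ otherwise. For $n\ge 2$, $$v_n(f_1,\ldots,f_n)=\sum_{\{I,J\}}(-1)^{|I|(n+1)+1}[\phi_I,\phi_J],$$ the sum being over unordered partitions $\{1,\ldots,n\}=I\sqcup J$ into nonempty subsets, $\phi_I=\phi_{|I|}(f_i)_{i\in I}$ with indices in increasing order, and $[\phi,\psi](a\otimes b\otimes c)=\phi(\psi(a\otimes b)\otimes c)-\phi(a\otimes\psi(b\otimes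 c))+\psi(\phi(a\otimes b)\otimes c)-\psi(a\otimes\phi(b\otimes c))$; and $$\phi_n(u\otimes v)=\Theta\, v_n(\beta_1\cdots\beta_{m-1}\otimes\beta_m\otimes\gamma_1)\gamma_2\cdots\gamma_r-\sum_{i=2}^r v_n(\beta_1\cdots\beta_m\otimes\gamma_1\cdots\gamma_{i-1}\otimes\gamma_i)\gamma_{i+1}\cdots\gamma_r,$$ where all $\phi_n,v_n$ are evaluated at $(f_1,\ldots,f_n)$, $\Theta=1$ if $\beta_m\gamma_1=0$ and $m\ge2$, and $\Theta=0$ otherwise. Finally $l_n(f_1,\ldots,f_n):\Bbbk AP_3\to A$ is given, for $n\ge2$, by $l_n(f_1,\ldots,f_n)(\alpha_1,\alpha_2,\alpha_3)=v_n(f_1,\ldots,f_n)(\alpha_1\otimes\alpha_2\otimes\alpha_3)$, and $l_1(f)=-\delta^2(f)$. Maurer-Cartan element: $f=\sum_{i\ge1}f_it^i$ with $f_i\in B^1(A)[1]$ (here $f_i=0$ for $i>m$) is a Maurer-Cartan element if for every $k\ge1$ $$-\delta^2(f_k)-\sum_{n\ge2}\ \sum_{j_1+\cdots+j_n=k}(-1)^{\frac{(n+1)n}{2}}\frac1{n!}\,l_n(f_{j_1},\ldots,f_{j_n})=0,$$ the inner sum being over ordered tuples of positive integers. A subquiver of the form $(\star)$ consists of vertices $1,2,3,4,5,6$, distinct arrows $\alpha_1:1\to2$, $\alpha_2:2\to3$, $\alpha_3:3\to4$, $\gamma_1:2\to5$, $\gamma_2:5\to3$, $\rho:5\to6$,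 $\delta_1:3\to6$, a path $v'$ from $1$ to $2$ different from $\alpha_1$, and a path $\delta_2\cdots\delta_s$ from $6$ to $4$ ($s\ge2$), such that $(\alpha_1,\alpha_2,\alpha_3)\in AP_3$ and the paths $v'$, $\gamma_1\gamma_2$ and $w'=\delta_1\cdots\delta_s$ are nonzero in $A$. *)

theory Defs
  imports
    "HOL-Library.Poly_Mapping"
    "HOL-Algebra.Ideal_Product"
    "HOL-Algebra.QuotRing"
    "Graph_Theory.Arc_Walk"
begin

section \<open>Linear combinations\<close>

definition scale :: "'k \<Rightarrow> ('p \<Rightarrow>\<^sub>0 'k) \<Rightarrow> ('p \<Rightarrow>\<^sub>0 'k::field)" where
  "scale c x = Poly_Mapping.map ((*) c) x"

definition basis :: "'p \<Rightarrow> ('p \<Rightarrow>\<^sub>0 'k::field)" where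
  "basis p = Poly_Mapping.single p 1"

definition lin :: "('p \<Rightarrow> ('q \<Rightarrow>\<^sub>0 'k)) \<Rightarrow> ('p \<Rightarrow>\<^sub>0 'k) \<Rightarrow> ('q \<Rightarrow>\<^sub>0 'k::field)" where
  "lin F x = (\<Sum>p\<in>Poly_Mapping.keys x. scale (Poly_Mapping.lookup x p) (F p))"

lemma lookup_scale [simp]: "Poly_Mapping.lookup (scale c x) p = c * Poly_Mapping.lookup x p"
  by (simp add: scale_def Poly_Mapping.map.rep_eq when_def)

lemma lookup_basis: "Poly_Mapping.lookup (basis p) q = (if p = q then 1 else 0)"
  by (simp add: basis_def lookup_single when_def)

lemma keys_basis [simp]: "Poly_Mapping.keys (basis p :: 'p \<Rightarrow>\<^sub>0 'k::field) = {p}"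
  by (simp add: basis_def)

lemma scale_zero [simp]: "scale c 0 = 0" "scale 0 x = 0"
  by (rule poly_mapping_eqI, simp)+

lemma scale_one [simp]: "scale 1 x = x"
  by (rule poly_mapping_eqI, simp)

lemma scale_scale [simp]: "scale c (scale d x) = scale (c * d) x"
  by (rule poly_mapping_eqI, simp)

lemma scale_add: "scale c (x + y) = scale c x + scale c y" "scale (c + d) x = scale c x + scale d x"
  by (rule poly_mapping_eqI, simp add: lookup_add algebra_simps)+

lemma scale_sum: "scale c (sum f S) = (\<Sum>i\<in>S. scale c (f i))"
  by (rule poly_mapping_eqI, simp add: lookup_sum sum_distrib_left)

lemma keys_scale: "Poly_Mapping.keys (scale c x) \<subseteq> Poly_Mapping.keys x"
  by (auto simp: in_keys_iff)

lemma keys_sum_le: "Poly_Mapping.keys (sum f S) \<subseteq> (\<Union>i\<in>S. Poly_Mapping.keys (f i))"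
  by (rule keys_sum)

lemma lin_superset:
  assumes "finite S" "Poly_Mapping.keys x \<subseteq> S"
  shows "lin F x = (\<Sum>p\<in>S. scale (Poly_Mapping.lookup x p) (F p))"
  unfolding lin_def using assms
  by (intro sum.mono_neutral_left) (auto simp: in_keys_iff)

lemma lin_zero [simp]: "lin F 0 = 0"
  by (simp add: lin_def)

lemma lin_basis [simp]: "lin F (basis p) = F p"
  by (simp add: lin_def lookup_basis)

lemma lin_add: "lin F (x + y) = lin F x + lin F y"
proof -
  let ?S = "Poly_Mapping.keys x \<union> Poly_Mapping.keys y"
  have "Poly_Mapping.keys (x + y) \<subseteq> ?S" by (rule keys_add)
  then show ?thesis
    by (simp add: lin_superset[of ?S] lookup_add scale_add sum.distrib)
qed

lemma lin_scale: "lin F (scale c x) = scale c (lin F x)"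
proof -
  have "lin F (scale c x) = (\<Sum>p\<in>Poly_Mapping.keys x. scale (Poly_Mapping.lookup (scale c x) p) (F p))"
    by (rule lin_superset) (simp_all add: keys_scale)
  then show ?thesis by (simp add: lin_def scale_sum)
qed

lemma lin_sum: "lin F (sum g S) = (\<Sum>i\<in>S. lin F (g i))"
  by (induction S rule: infinite_finite_induct) (auto simp: lin_add)

lemma lin_lin: "lin F (lin H x) = lin (\<lambda>p. lin F (H p)) x"
  by (simp add: lin_def[of H] lin_def[of "\<lambda>p. lin F (H p)"] lin_sum lin_scale)

lemma lin_add_fun: "lin (\<lambda>p. F p + H p) x = lin F x + lin H x"
  by (simp add: lin_def scale_add sum.distrib)

lemma lin_cong: "(\<And>p. p \<in> Poly_Mapping.keys x \<Longrightarrow> F p = H p) \<Longrightarrow> lin F x = lin H x"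
  by (simp add: lin_def)

lemma lin_basis_id: "lin basis x = x"
proof (rule poly_mapping_eqI)
  fix q
  have "Poly_Mapping.lookup (lin basis x) q
      = (\<Sum>p\<in>Poly_Mapping.keys x. if p = q then Poly_Mapping.lookup x q else 0)"
    unfolding lin_def lookup_sum by (rule sum.cong) (auto simp: lookup_basis)
  also have "\<dots> = Poly_Mapping.lookup x q" by (simp add: in_keys_iff)
  finally show "Poly_Mapping.lookup (lin basis x) q = Poly_Mapping.lookup x q" .
qed

lemma keys_lin: "Poly_Mapping.keys (lin F x) \<subseteq> (\<Union>p\<in>Poly_Mapping.keys x. Poly_Mapping.keys (F p))"
  unfolding lin_def using keys_sum_le keys_scale by fastforce

section \<open>Quivers and path algebras\<close>

text \<open>
  A quiver is a \<^typ>\<open>('v, 'e) pre_digraph\<close>; \<^const>\<open>tail\<close> is the source and \<^const>\<open>head\<close> the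
  target of an arrow.  A path is recorded with its starting vertex, so that \<open>(v, [])\<close> is the
  trivial path at \<open>v\<close>.
\<close>

type_synonym ('v, 'e) qpath = "'v \<times> 'e list"

definition paths :: "('v, 'e) pre_digraph \<Rightarrow> ('v, 'e) qpath set" where
  "paths G = {(u, es) | u es. \<exists>w. pre_digraph.awalk G u es w}"

definition target :: "('v, 'e) pre_digraph \<Rightarrow> ('v, 'e) qpath \<Rightarrow> 'v" where
  "target G p = last (pre_digraph.awalk_verts G (fst p) (snd p))"

definition parallel_paths :: "('v, 'e) pre_digraph \<Rightarrow> ('v, 'e) qpath \<Rightarrow> ('v, 'e) qpath \<Rightarrow> bool" where
  "parallel_paths G p q \<longleftrightarrow> fst p = fst q \<and> target G p = target G q"

definition composable :: "('v, 'e) pre_digraph \<Rightarrow> ('v, 'e) qpath \<Rightarrow> ('v, 'e) qpath \<Rightarrow> bool" where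
  "composable G p q \<longleftrightarrow> target G p = fst q"

definition arrow :: "('v, 'e) pre_digraph \<Rightarrow> 'e \<Rightarrow> ('v, 'e) qpath" where
  "arrow G a = (tail G a, [a])"

definition concat_paths ::
  "('v, 'e) pre_digraph \<Rightarrow> ('v, 'e) qpath \<Rightarrow> ('v, 'e) qpath \<Rightarrow> (('v, 'e) qpath \<Rightarrow>\<^sub>0 'k::field)" where
  "concat_paths G p q = (if composable G p q then basis (fst p, snd p @ snd q) else 0)"

definition path_algebra :: "('v, 'e) pre_digraph \<Rightarrow> (('v, 'e) qpath \<Rightarrow>\<^sub>0 'k::field) ring" where
  "path_algebra G = \<lparr>carrier = {x. Poly_Mapping.keys x \<subseteq> paths G},
     mult = (\<lambda>x y. lin (\<lambda>p. lin (concat_paths G p) y) x),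
     one = (\<Sum>v\<in>verts G. basis (v, [])), zero = 0, add = (+)\<rparr>"

lemma awalk_verts_nonempty: "pre_digraph.awalk_verts G u es \<noteq> []"
  by (cases es) (auto simp: pre_digraph.awalk_verts.simps)

lemma target_simp: "target G (u, es) = (if es = [] then u else head G (last es))"
  unfolding target_def
  by (induction es arbitrary: u) (auto simp: pre_digraph.awalk_verts.simps awalk_verts_nonempty)

lemma target_append:
  "target G (u, es) = w \<Longrightarrow> target G (u, es @ fs) = target G (w, fs)"
  by (auto simp: target_simp)

lemma (in wf_digraph) awalk_target: "awalk u es w \<Longrightarrow> target G (u, es) = w"
  by (auto simp: target_def)

lemma (in wf_digraph) paths_concat:
  assumes "p \<in> paths G" "q \<in> paths G" "composable G p q"
  shows "(fst p, snd p @ snd q) \<in> paths G"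
  using assms by (auto simp: paths_def composable_def awalk_target intro: awalk_appendI)

lemma path_algebra_simps [simp]:
  "x \<in> carrier (path_algebra G) \<longleftrightarrow> Poly_Mapping.keys x \<subseteq> paths G"
  "x \<otimes>\<^bsub>path_algebra G\<^esub> y = lin (\<lambda>p. lin (concat_paths G p) y) x"
  "x \<oplus>\<^bsub>path_algebra G\<^esub> y = x + y"
  "\<zero>\<^bsub>path_algebra G\<^esub> = 0"
  "\<one>\<^bsub>path_algebra G\<^esub> = (\<Sum>v\<in>verts G. basis (v, []))"
  by (simp_all add: path_algebra_def)

lemma path_algebra_assoc:
  fixes x y z :: "('a, 'b) qpath \<Rightarrow>\<^sub>0 'c::field"
  shows "(x \<otimes>\<^bsub>path_algebra G\<^esub> y) \<otimes>\<^bsub>path_algebra G\<^esub> z = x \<otimes>\<^bsub>path_algebra G\<^esub> (y \<otimes>\<^bsub>path_algebra G\<^esub> z)"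
proof -
  have *: "lin (\<lambda>s. lin (concat_paths G s) z) (concat_paths G p q)
      = lin (\<lambda>r. lin (concat_paths G p) (concat_paths G q r)) z" (is "?L = ?R") for p q
  proof (cases "composable G p q")
    case True
    then have t: "target G (fst p, snd p @ snd q) = target G q"
      by (metis composable_def prod.collapse target_append)
    have "lin (concat_paths G p) (concat_paths G q r) = (concat_paths G (fst p, snd p @ snd q) r :: _ \<Rightarrow>\<^sub>0 'c)" for r
      using True t by (auto simp: concat_paths_def composable_def)
    then have "?R = lin (concat_paths G (fst p, snd p @ snd q)) z" by (simp cong: lin_cong)
    moreover have "?L = lin (concat_paths G (fst p, snd p @ snd q)) z"
      using True by (simp add: concat_paths_def[of G p q])
    ultimately show ?thesis by simp
  next
    case False
    then have "lin (concat_paths G p) (concat_paths G q r) = (0 :: _ \<Rightarrow>\<^sub>0 'c)" for r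
      by (auto simp: concat_paths_def composable_def)
    then have "?R = 0" by (simp add: lin_def[of _ z])
    moreover have "?L = 0" using False by (simp add: concat_paths_def[of G p q])
    ultimately show ?thesis by simp
  qed
  show ?thesis by (simp add: lin_lin *)
qed

lemma (in fin_digraph) path_algebra_ring:
  "ring (path_algebra G :: (('a, 'b) qpath \<Rightarrow>\<^sub>0 'k::field) ring)"
proof (rule ringI)
  let ?K = "path_algebra G :: (('a, 'b) qpath \<Rightarrow>\<^sub>0 'k::field) ring"
  show "abelian_group ?K"
  proof (rule abelian_groupI; (simp add: ac_simps; fail)?)
    show "x \<oplus>\<^bsub>?K\<^esub> y \<in> carrier ?K" if "x \<in> carrier ?K" "y \<in> carrier ?K" for x y
      using that keys_add[of x y] by auto
    show "\<exists>y\<in>carrier ?K. y \<oplus>\<^bsub>?K\<^esub> x = \<zero>\<^bsub>?K\<^esub>" if "x \<in> carrier ?K" for x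
      using that by (intro bexI[of _ "- x"]) auto
  qed
  show "monoid ?K"
  proof (rule monoidI)
    show "x \<otimes>\<^bsub>?K\<^esub> y \<in> carrier ?K" if "x \<in> carrier ?K" "y \<in> carrier ?K" for x y
    proof -
      have "Poly_Mapping.keys (concat_paths G p q :: _ \<Rightarrow>\<^sub>0 'k) \<subseteq> paths G"
        if "p \<in> Poly_Mapping.keys x" "q \<in> Poly_Mapping.keys y" for p q
      proof -
        have "p \<in> paths G" "q \<in> paths G"
          using that \<open>x \<in> carrier ?K\<close> \<open>y \<in> carrier ?K\<close> by auto
        then show ?thesis using paths_concat[of p q] by (simp add: concat_paths_def)
      qed
      then have "Poly_Mapping.keys (lin (concat_paths G p) y) \<subseteq> paths G"
        if "p \<in> Poly_Mapping.keys x" for p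
        using that keys_lin[of "concat_paths G p" y] by blast
      then show ?thesis
        using keys_lin[of "\<lambda>p. lin (concat_paths G p) y" x] by (simp, blast)
    qed
    show "\<one>\<^bsub>?K\<^esub> \<in> carrier ?K"
    proof -
      have "(v, []) \<in> paths G" if "v \<in> verts G" for v
        using that by (auto simp: paths_def awalk_def)
      then show ?thesis
        using keys_sum_le[of "\<lambda>v. basis (v, []) :: _ \<Rightarrow>\<^sub>0 'k" "verts G"] by auto
    qed
    show "x \<otimes>\<^bsub>?K\<^esub> y \<otimes>\<^bsub>?K\<^esub> z = x \<otimes>\<^bsub>?K\<^esub> (y \<otimes>\<^bsub>?K\<^esub> z)" for x y z
      by (rule path_algebra_assoc)
    have vin: "fst p \<in> verts G" "target G p \<in> verts G" if "p \<in> paths G" for p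
      using that by (auto simp: paths_def awalk_target)
    show "\<one>\<^bsub>?K\<^esub> \<otimes>\<^bsub>?K\<^esub> x = x" if x: "x \<in> carrier ?K" for x
    proof -
      have "(\<Sum>v\<in>verts G. concat_paths G (v, []) p) = (basis p :: _ \<Rightarrow>\<^sub>0 'k)" if "p \<in> paths G" for p
        using vin[OF that] by (simp add: concat_paths_def composable_def target_simp
            if_distrib[of basis] cong: if_cong)
      moreover have "(\<Sum>v\<in>S. lin (concat_paths G (v, [])) x)
          = lin (\<lambda>p. \<Sum>v\<in>S. concat_paths G (v, []) p) x" if "finite S" for S
        using that by (induction S) (auto simp: lin_add_fun lin_def)
      ultimately have "\<one>\<^bsub>?K\<^esub> \<otimes>\<^bsub>?K\<^esub> x = lin basis x"
        using x by (auto simp: lin_sum intro!: lin_cong)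
      then show ?thesis by (simp only: lin_basis_id)
    qed
    show "x \<otimes>\<^bsub>?K\<^esub> \<one>\<^bsub>?K\<^esub> = x" if x: "x \<in> carrier ?K" for x
    proof -
      have "(\<Sum>v\<in>verts G. concat_paths G p (v, [])) = (basis p :: _ \<Rightarrow>\<^sub>0 'k)" if "p \<in> paths G" for p
        using vin[OF that] by (simp add: concat_paths_def composable_def cong: if_cong)
      then have "x \<otimes>\<^bsub>?K\<^esub> \<one>\<^bsub>?K\<^esub> = lin basis x"
        using x by (auto simp: lin_sum intro!: lin_cong)
      then show ?thesis by (simp only: lin_basis_id)
    qed
  qed
  show "(x \<oplus>\<^bsub>?K\<^esub> y) \<otimes>\<^bsub>?K\<^esub> z = x \<otimes>\<^bsub>?K\<^esub> z \<oplus>\<^bsub>?K\<^esub> y \<otimes>\<^bsub>?K\<^esub> z" for x y z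
    by (simp add: lin_add)
  show "z \<otimes>\<^bsub>?K\<^esub> (x \<oplus>\<^bsub>?K\<^esub> y) = z \<otimes>\<^bsub>?K\<^esub> x \<oplus>\<^bsub>?K\<^esub> z \<otimes>\<^bsub>?K\<^esub> y" for x y z
    by (simp add: lin_add lin_add_fun)
qed

section \<open>Admissible, quadratic and gentle ideals\<close>

definition arrow_ideal :: "('v, 'e) pre_digraph \<Rightarrow> (('v, 'e) qpath \<Rightarrow>\<^sub>0 'k::field) set" where
  "arrow_ideal G = genideal (path_algebra G) ((\<lambda>a. basis (arrow G a)) ` arcs G)"

definition arrow_ideal_power :: "('v, 'e) pre_digraph \<Rightarrow> nat \<Rightarrow> (('v, 'e) qpath \<Rightarrow>\<^sub>0 'k::field) set" where
  "arrow_ideal_power G n =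
     (ideal_prod (path_algebra G) (arrow_ideal G) ^^ n) (carrier (path_algebra G))"

definition admissible :: "('v, 'e) pre_digraph \<Rightarrow> (('v, 'e) qpath \<Rightarrow>\<^sub>0 'k::field) set \<Rightarrow> bool" where
  "admissible G I \<longleftrightarrow> ideal I (path_algebra G) \<and> I \<subseteq> arrow_ideal_power G 2 \<and>
     (\<exists>N\<ge>2. arrow_ideal_power G N \<subseteq> I)"

definition quadratic :: "('v, 'e) pre_digraph \<Rightarrow> (('v, 'e) qpath \<Rightarrow>\<^sub>0 'k::field) set \<Rightarrow> bool" where
  "quadratic G I \<longleftrightarrow> (\<exists>R \<subseteq> {p \<in> paths G. length (snd p) = 2}. I = genideal (path_algebra G) (basis ` R))"

definition nonzero_paths :: "('v, 'e) pre_digraph \<Rightarrow> (('v, 'e) qpath \<Rightarrow>\<^sub>0 'k::field) set \<Rightarrow> ('v, 'e) qpath set" where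
  "nonzero_paths G I = {p \<in> paths G. basis p \<notin> I}"

definition zero_rel :: "('v, 'e) pre_digraph \<Rightarrow> (('v, 'e) qpath \<Rightarrow>\<^sub>0 'k::field) set \<Rightarrow> 'e \<Rightarrow> 'e \<Rightarrow> bool" where
  "zero_rel G I a b \<longleftrightarrow> a \<in> arcs G \<and> b \<in> arcs G \<and> head G a = tail G b \<and> basis (tail G a, [a, b]) \<in> I"

definition nonzero_rel :: "('v, 'e) pre_digraph \<Rightarrow> (('v, 'e) qpath \<Rightarrow>\<^sub>0 'k::field) set \<Rightarrow> 'e \<Rightarrow> 'e \<Rightarrow> bool" where
  "nonzero_rel G I a b \<longleftrightarrow> a \<in> arcs G \<and> b \<in> arcs G \<and> head G a = tail G b \<and> basis (tail G a, [a, b]) \<notin> I"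

definition gentle :: "('v, 'e) pre_digraph \<Rightarrow> (('v, 'e) qpath \<Rightarrow>\<^sub>0 'k::field) set \<Rightarrow> bool" where
  "gentle G I \<longleftrightarrow> quadratic G I \<and> (\<forall>a\<in>arcs G.
     (\<exists>\<^sub>\<le>\<^sub>1 b. zero_rel G I a b) \<and> (\<exists>\<^sub>\<le>\<^sub>1 c. zero_rel G I c a) \<and>
     (\<exists>\<^sub>\<le>\<^sub>1 b. nonzero_rel G I a b) \<and> (\<exists>\<^sub>\<le>\<^sub>1 c. nonzero_rel G I c a))"

section \<open>The algebra \<open>A = kQ/I\<close>\<close>

text \<open>
  For a monomial ideal the classes of the nonzero paths form a basis of the quotient, and elements
  of \<open>A\<close> are represented by their coordinates in this basis.  The lemma \<open>quotient_iso\<close> below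
  identifies this ring with the quotient ring \<open>kQ/I\<close>.
\<close>

definition normal_form ::
  "('v, 'e) pre_digraph \<Rightarrow> (('v, 'e) qpath \<Rightarrow>\<^sub>0 'k::field) set \<Rightarrow> (('v, 'e) qpath \<Rightarrow>\<^sub>0 'k) \<Rightarrow> (('v, 'e) qpath \<Rightarrow>\<^sub>0 'k)" where
  "normal_form G I = lin (\<lambda>p. if p \<in> nonzero_paths G I then basis p else 0)"

definition quiver_algebra ::
  "('v, 'e) pre_digraph \<Rightarrow> (('v, 'e) qpath \<Rightarrow>\<^sub>0 'k::field) set \<Rightarrow> (('v, 'e) qpath \<Rightarrow>\<^sub>0 'k) ring" where
  "quiver_algebra G I = \<lparr>carrier = {x. Poly_Mapping.keys x \<subseteq> nonzero_paths G I},
     mult = (\<lambda>x y. normal_form G I (x \<otimes>\<^bsub>path_algebra G\<^esub> y)),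
     one = normal_form G I \<one>\<^bsub>path_algebra G\<^esub>, zero = 0, add = (+)\<rparr>"

definition path_class ::
  "('v, 'e) pre_digraph \<Rightarrow> (('v, 'e) qpath \<Rightarrow>\<^sub>0 'k::field) set \<Rightarrow> ('v, 'e) qpath \<Rightarrow> (('v, 'e) qpath \<Rightarrow>\<^sub>0 'k)" where
  "path_class G I p = normal_form G I (basis p)"

lemma quiver_algebra_simps [simp]:
  "x \<in> carrier (quiver_algebra G I) \<longleftrightarrow> Poly_Mapping.keys x \<subseteq> nonzero_paths G I"
  "x \<otimes>\<^bsub>quiver_algebra G I\<^esub> y = normal_form G I (x \<otimes>\<^bsub>path_algebra G\<^esub> y)"
  "x \<oplus>\<^bsub>quiver_algebra G I\<^esub> y = x + y"
  "\<zero>\<^bsub>quiver_algebra G I\<^esub> = 0"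
  "\<one>\<^bsub>quiver_algebra G I\<^esub> = normal_form G I \<one>\<^bsub>path_algebra G\<^esub>"
  by (simp_all add: quiver_algebra_def)

lemma (in fin_digraph) ideal_scale:
  fixes I :: "(('a, 'b) qpath \<Rightarrow>\<^sub>0 'k::field) set"
  assumes I: "ideal I (path_algebra G)" and p: "p \<in> paths G" and b: "basis p \<in> I"
  shows "scale c (basis p) \<in> I"
proof -
  have "(fst p, []) \<in> paths G"
    using p by (auto simp: paths_def awalk_def)
  then have "scale c (basis (fst p, [])) \<in> carrier (path_algebra G)"
    using keys_scale[of c "basis (fst p, [])"] by auto
  then have "scale c (basis (fst p, [])) \<otimes>\<^bsub>path_algebra G\<^esub> basis p \<in> I"
    by (rule ideal.I_l_closed[OF I b])
  moreover have "scale c (basis (fst p, [])) \<otimes>\<^bsub>path_algebra G\<^esub> basis p = scale c (basis p)"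
    by (simp add: lin_scale concat_paths_def composable_def target_simp)
  ultimately show ?thesis by simp
qed

lemma (in fin_digraph) ideal_keys:
  fixes I :: "(('a, 'b) qpath \<Rightarrow>\<^sub>0 'k::field) set"
  assumes I: "ideal I (path_algebra G)" and x: "x \<in> carrier (path_algebra G)"
    and k: "\<And>p. p \<in> Poly_Mapping.keys x \<Longrightarrow> basis p \<in> I"
  shows "x \<in> I"
proof -
  have z: "0 \<in> I" using additive_subgroup.zero_closed[OF ideal.axioms(1)[OF I]] by simp
  have a: "y + z \<in> I" if "y \<in> I" "z \<in> I" for y z
    using additive_subgroup.a_closed[OF ideal.axioms(1)[OF I] that] by simp
  have "(\<Sum>p\<in>S. scale (c p) (basis p)) \<in> I" if "finite S" "S \<subseteq> Poly_Mapping.keys x" for S c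
    using that by (induction S) (use x k in \<open>auto intro!: z a ideal_scale[OF I]\<close>)
  then have "lin basis x \<in> I" unfolding lin_def by simp
  then show ?thesis by (simp only: lin_basis_id)
qed

lemma (in fin_digraph) path_algebra_mult_keys:
  assumes "r \<in> Poly_Mapping.keys (x \<otimes>\<^bsub>path_algebra G\<^esub> y)"
  obtains p q where "p \<in> Poly_Mapping.keys x" "q \<in> Poly_Mapping.keys y" "composable G p q"
    "r = (fst p, snd p @ snd q)"
proof -
  obtain p where p: "p \<in> Poly_Mapping.keys x" "r \<in> Poly_Mapping.keys (lin (concat_paths G p) y)"
    using assms keys_lin[of "\<lambda>p. lin (concat_paths G p) y" x] by auto
  then obtain q where q: "q \<in> Poly_Mapping.keys y" "r \<in> Poly_Mapping.keys (concat_paths G p q :: _ \<Rightarrow>\<^sub>0 'c)"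
    using keys_lin[of "concat_paths G p" y] by blast
  then have "composable G p q" "r = (fst p, snd p @ snd q)"
    by (auto simp: concat_paths_def split: if_splits)
  then show ?thesis using that p q by blast
qed

text \<open>An ideal generated by paths is monomial.\<close>

lemma (in fin_digraph) quadratic_monomial:
  fixes I :: "(('a, 'b) qpath \<Rightarrow>\<^sub>0 'k::field) set"
  assumes q: "quadratic G I"
  shows "ideal I (path_algebra G)"
    and "x \<in> I \<longleftrightarrow> Poly_Mapping.keys x \<subseteq> paths G \<and> (\<forall>p\<in>Poly_Mapping.keys x. basis p \<in> I)"
proof -
  let ?K = "path_algebra G :: (('a, 'b) qpath \<Rightarrow>\<^sub>0 'k::field) ring"
  interpret K: ring ?K by (rule path_algebra_ring)
  obtain R where R: "R \<subseteq> paths G" "I = genideal ?K (basis ` R)"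
    using q unfolding quadratic_def by blast
  have c: "basis ` R \<subseteq> carrier ?K" using R by auto
  show I: "ideal I ?K" using K.genideal_ideal[OF c] R by simp
  interpret I: ideal I ?K by (rule I)
  define M where "M = {x :: ('a, 'b) qpath \<Rightarrow>\<^sub>0 'k. Poly_Mapping.keys x \<subseteq> paths G \<and> (\<forall>p\<in>Poly_Mapping.keys x. basis p \<in> I)}"
  have "ideal M ?K"
  proof (rule idealI)
    show "ring ?K" by (rule path_algebra_ring)
    show "subgroup M (add_monoid ?K)"
    proof (rule K.add.subgroupI)
      show "M \<subseteq> carrier ?K" by (auto simp: M_def)
      show "M \<noteq> {}" by (auto simp: M_def intro!: exI[of _ 0])
      show "a \<oplus>\<^bsub>?K\<^esub> b \<in> M" if "a \<in> M" "b \<in> M" for a b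
        using that keys_add[of a b] by (auto simp: M_def)
      show "\<ominus>\<^bsub>?K\<^esub> a \<in> M" if "a \<in> M" for a
      proof -
        have "\<ominus>\<^bsub>?K\<^esub> a = - a"
          using that by (intro K.minus_equality) (auto simp: M_def)
        then show ?thesis using that by (simp add: M_def)
      qed
    qed
    show "x \<otimes>\<^bsub>?K\<^esub> a \<in> M" if a: "a \<in> M" and x: "x \<in> carrier ?K" for a x
    proof -
      have "r \<in> paths G \<and> (basis r :: _ \<Rightarrow>\<^sub>0 'k) \<in> I" if "r \<in> Poly_Mapping.keys (x \<otimes>\<^bsub>?K\<^esub> a)" for r
        using that
      proof (rule path_algebra_mult_keys)
        fix p q assume pq: "p \<in> Poly_Mapping.keys x" "q \<in> Poly_Mapping.keys a" "composable G p q"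
          "r = (fst p, snd p @ snd q)"
        have "basis p \<otimes>\<^bsub>?K\<^esub> basis q \<in> I"
          using pq a x by (intro I.I_l_closed) (auto simp: M_def)
        moreover have "r \<in> paths G" using pq a x by (auto simp: M_def intro!: paths_concat)
        ultimately show ?thesis using pq by (simp add: concat_paths_def)
      qed
      then show ?thesis unfolding M_def by blast
    qed
    show "a \<otimes>\<^bsub>?K\<^esub> x \<in> M" if a: "a \<in> M" and x: "x \<in> carrier ?K" for a x
    proof -
      have "r \<in> paths G \<and> (basis r :: _ \<Rightarrow>\<^sub>0 'k) \<in> I" if "r \<in> Poly_Mapping.keys (a \<otimes>\<^bsub>?K\<^esub> x)" for r
        using that
      proof (rule path_algebra_mult_keys)
        fix p q assume pq: "p \<in> Poly_Mapping.keys a" "q \<in> Poly_Mapping.keys x" "composable G p q"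
          "r = (fst p, snd p @ snd q)"
        have "basis p \<otimes>\<^bsub>?K\<^esub> basis q \<in> I"
          using pq a x by (intro I.I_r_closed) (auto simp: M_def)
        moreover have "r \<in> paths G" using pq a x by (auto simp: M_def intro!: paths_concat)
        ultimately show ?thesis using pq by (simp add: concat_paths_def)
      qed
      then show ?thesis unfolding M_def by blast
    qed
  qed
  moreover have "basis ` R \<subseteq> M"
    using R K.genideal_self[OF c] by (auto simp: M_def)
  ultimately have "I \<subseteq> M" using K.genideal_minimal R by blast
  then show "x \<in> I \<longleftrightarrow> Poly_Mapping.keys x \<subseteq> paths G \<and> (\<forall>p\<in>Poly_Mapping.keys x. basis p \<in> I)"
    using ideal_keys[OF I, of x] by (auto simp: M_def)
qed

lemma lookup_normal_form:
  "Poly_Mapping.lookup (normal_form G I x) p = (if p \<in> nonzero_paths G I then Poly_Mapping.lookup x p else 0)"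
proof -
  have "Poly_Mapping.lookup (normal_form G I x) p = (\<Sum>q\<in>Poly_Mapping.keys x.
      if q = p then (if p \<in> nonzero_paths G I then Poly_Mapping.lookup x p else 0) else 0)"
    unfolding normal_form_def lin_def lookup_sum by (rule sum.cong) (auto simp: lookup_basis)
  also have "\<dots> = (if p \<in> nonzero_paths G I then Poly_Mapping.lookup x p else 0)"
    by (auto simp: in_keys_iff)
  finally show ?thesis .
qed

lemma normal_form_fixes: "Poly_Mapping.keys x \<subseteq> nonzero_paths G I \<Longrightarrow> normal_form G I x = x"
  by (rule poly_mapping_eqI) (auto simp: lookup_normal_form in_keys_iff)

lemma keys_normal_form: "Poly_Mapping.keys (normal_form G I x) = Poly_Mapping.keys x \<inter> nonzero_paths G I"
  by (auto simp: in_keys_iff lookup_normal_form split: if_splits)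

lemma (in fin_digraph) normal_form_kernel:
  fixes I :: "(('a, 'b) qpath \<Rightarrow>\<^sub>0 'k::field) set"
  assumes "quadratic G I" "x \<in> carrier (path_algebra G)"
  shows "normal_form G I x = 0 \<longleftrightarrow> x \<in> I"
proof -
  have "normal_form G I x = 0 \<longleftrightarrow> Poly_Mapping.keys (normal_form G I x) = {}" by simp
  also have "\<dots> \<longleftrightarrow> x \<in> I"
    using assms(2) by (auto simp: keys_normal_form quadratic_monomial(2)[OF assms(1), of x] nonzero_paths_def)
  finally show ?thesis .
qed

lemma (in fin_digraph) normal_form_hom:
  fixes I :: "(('a, 'b) qpath \<Rightarrow>\<^sub>0 'k::field) set"
  assumes q: "quadratic G I"
  shows "normal_form G I \<in> ring_hom (path_algebra G) (quiver_algebra G I)"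
proof (rule ring_hom_memI)
  let ?N = "\<lambda>p. if p \<in> nonzero_paths G I then (basis p :: _ \<Rightarrow>\<^sub>0 'k) else 0"
  interpret I: ideal I "path_algebra G" by (rule quadratic_monomial(1)[OF q])
  fix x y :: "('a, 'b) qpath \<Rightarrow>\<^sub>0 'k"
  assume xy: "x \<in> carrier (path_algebra G)" "y \<in> carrier (path_algebra G)"
  have *: "normal_form G I (concat_paths G p r)
      = normal_form G I (lin (\<lambda>p'. lin (concat_paths G p') (?N r)) (?N p))"
    if pr: "p \<in> paths G" "r \<in> paths G" for p r
  proof (cases "p \<in> nonzero_paths G I \<and> r \<in> nonzero_paths G I")
    case False
    then have "basis p \<in> I \<or> basis r \<in> I" using pr by (auto simp: nonzero_paths_def)
    then have "basis p \<otimes>\<^bsub>path_algebra G\<^esub> basis r \<in> I"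
      using I.I_l_closed[of "basis r" "basis p"] I.I_r_closed[of "basis p" "basis r"] pr by auto
    then have "concat_paths G p r \<in> I" by simp
    then have "normal_form G I (concat_paths G p r) = 0"
      using normal_form_kernel[OF q, of "concat_paths G p r"] I.a_subset by blast
    moreover have "lin (\<lambda>p'. lin (concat_paths G p') (?N r)) (?N p) = 0"
      using False by (auto simp: lin_def)
    ultimately show ?thesis by (simp add: normal_form_def)
  qed auto
  have "normal_form G I (x \<otimes>\<^bsub>path_algebra G\<^esub> y)
      = lin (\<lambda>p. lin (\<lambda>r. normal_form G I (concat_paths G p r)) y) x"
    by (simp add: normal_form_def lin_lin)
  also have "\<dots> = lin (\<lambda>p. lin (\<lambda>r. normal_form G I (lin (\<lambda>p'. lin (concat_paths G p') (?N r)) (?N p))) y) x"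
    using xy by (intro lin_cong *) auto
  also have "\<dots> = normal_form G I (normal_form G I x \<otimes>\<^bsub>path_algebra G\<^esub> normal_form G I y)"
  proof -
    have "lin (\<lambda>r. normal_form G I (lin (\<lambda>p'. lin (concat_paths G p') (?N r)) (?N p))) y
       = normal_form G I (lin (\<lambda>p'. lin (concat_paths G p') (normal_form G I y)) (?N p))" for p
      by (cases "p \<in> nonzero_paths G I") (simp_all add: normal_form_def lin_lin lin_def[of "\<lambda>r. 0"])
    then show ?thesis by (simp add: normal_form_def lin_lin)
  qed
  finally show "normal_form G I (x \<otimes>\<^bsub>path_algebra G\<^esub> y)
      = normal_form G I x \<otimes>\<^bsub>quiver_algebra G I\<^esub> normal_form G I y" by simp
next
  show "normal_form G I x \<in> carrier (quiver_algebra G I)" for x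
    by (simp add: keys_normal_form)
  show "normal_form G I (x \<oplus>\<^bsub>path_algebra G\<^esub> y)
      = normal_form G I x \<oplus>\<^bsub>quiver_algebra G I\<^esub> normal_form G I y" for x y
    by (simp add: normal_form_def lin_add)
qed simp

theorem (in fin_digraph) quotient_iso:
  fixes I :: "(('a, 'b) qpath \<Rightarrow>\<^sub>0 'k::field) set"
  assumes q: "quadratic G I"
  shows "ring (quiver_algebra G I)" and "path_algebra G Quot I \<simeq> quiver_algebra G I"
proof -
  let ?K = "path_algebra G :: (('a, 'b) qpath \<Rightarrow>\<^sub>0 'k::field) ring"
  let ?A = "quiver_algebra G I"
  interpret K: ring ?K by (rule path_algebra_ring)
  have surj: "normal_form G I ` carrier ?K = carrier ?A"
  proof (intro equalityI subsetI)
    fix x assume "x \<in> carrier ?A"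
    moreover from this have "x \<in> carrier ?K" by (auto simp: nonzero_paths_def)
    ultimately show "x \<in> normal_form G I ` carrier ?K"
      using normal_form_fixes[of x G I] by (metis image_eqI quiver_algebra_simps(1))
  qed (auto simp: keys_normal_form)
  have "ring (?A \<lparr>carrier := normal_form G I ` carrier ?K, zero := normal_form G I \<zero>\<^bsub>?K\<^esub>\<rparr>)"
    by (rule K.ring_hom_imp_img_ring[OF normal_form_hom[OF q]])
  moreover have "?A \<lparr>carrier := normal_form G I ` carrier ?K, zero := normal_form G I \<zero>\<^bsub>?K\<^esub>\<rparr> = ?A"
    unfolding surj by (simp add: quiver_algebra_def normal_form_def)
  ultimately show A: "ring ?A" by simp
  have h: "ring_hom_ring ?K ?A (normal_form G I)"
    by (rule ring_hom_ringI2[OF path_algebra_ring A normal_form_hom[OF q]])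
  have "I \<subseteq> carrier ?K" 
    by (rule subsetI, drule iffD1[OF quadratic_monomial(2)[OF q]]) simp
  moreover have "a_kernel ?K ?A (normal_form G I) = {x \<in> carrier ?K. normal_form G I x = 0}"
    by (simp add: a_kernel_def')
  ultimately have "a_kernel ?K ?A (normal_form G I) = I"
    using normal_form_kernel[OF q] by blast
  then show "?K Quot I \<simeq> ?A" using ring_hom_ring.FactRing_iso[OF h surj] by simp
qed


lemma (in fin_digraph) arrow_ideal_power_path:
  "p \<in> paths G \<Longrightarrow> n \<le> length (snd p) \<Longrightarrow>
     (basis p :: ('a, 'b) qpath \<Rightarrow>\<^sub>0 'k::field) \<in> arrow_ideal_power G n"
proof (induction n arbitrary: p)
  case (Suc n)
  let ?K = "path_algebra G :: (('a, 'b) qpath \<Rightarrow>\<^sub>0 'k::field) ring"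
  interpret K: ring ?K by (rule path_algebra_ring)
  obtain u a es where p: "p = (u, a # es)" using Suc.prems by (cases p; cases "snd p") auto
  then have a: "a \<in> arcs G" "tail G a = u" and es: "(head G a, es) \<in> paths G"
    using Suc.prems by (auto simp: paths_def awalk_Cons_iff)
  have "basis ` arrow G ` arcs G \<subseteq> carrier ?K"
    by (auto simp: arrow_def paths_def intro!: arc_implies_awalk exI)
  then have "basis (arrow G a) \<in> (arrow_ideal G :: (_ \<Rightarrow>\<^sub>0 'k) set)"
    unfolding arrow_ideal_def using a K.genideal_self by (auto simp: image_image subset_iff)
  then have "basis (arrow G a) \<otimes>\<^bsub>?K\<^esub> basis (head G a, es) \<in> arrow_ideal_power G (Suc n)"
    unfolding arrow_ideal_power_def using Suc.IH[OF es] Suc.prems(2) p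
    by (auto simp: arrow_ideal_power_def simp del: path_algebra_simps intro!: ideal_prod.prod)
  then show ?case
    using p a by (simp add: arrow_def concat_paths_def composable_def target_simp)
qed (simp add: arrow_ideal_power_def)

text \<open>\<open>A\<close> is finite dimensional as soon as \<open>I\<close> is admissible.\<close>

lemma (in fin_digraph) finite_nonzero_paths:
  assumes "admissible G I"
  shows "finite (nonzero_paths G I)"
proof -
  obtain N where "arrow_ideal_power G N \<subseteq> I" using assms by (auto simp: admissible_def)
  then have "nonzero_paths G I \<subseteq> verts G \<times> {es. set es \<subseteq> arcs G \<and> length es \<le> N}"
    using arrow_ideal_power_path[of _ N]
    by (force simp: nonzero_paths_def paths_def awalk_def not_le[symmetric] dest: less_imp_le)
  then show ?thesis
    by (rule finite_subset) (simp add: finite_lists_length_le)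
qed

section \<open>The Bardzell complex in degree one\<close>

definition AP :: "('v, 'e) pre_digraph \<Rightarrow> (('v, 'e) qpath \<Rightarrow>\<^sub>0 'k::field) set \<Rightarrow> nat \<Rightarrow> 'e list set" where
  "AP G I n = {as. length as = n \<and> set as \<subseteq> arcs G \<and>
     (\<forall>i. Suc i < n \<longrightarrow> zero_rel G I (as ! i) (as ! Suc i))}"

text \<open>
  \<open>Hom\<^sub>E\<^sub>-\<^sub>E(k AP\<^sub>2, A)\<close>: a linear map is given by its values on \<open>AP\<^sub>2\<close>, and
  is extended by 0 to all other lists of arrows so that distinct functions are distinct maps.
\<close>

type_synonym ('v, 'e, 'k) cochain = "'e list \<Rightarrow> (('v, 'e) qpath \<Rightarrow>\<^sub>0 'k)"

definition B1 :: "('v, 'e) pre_digraph \<Rightarrow> (('v, 'e) qpath \<Rightarrow>\<^sub>0 'k::field) set \<Rightarrow> ('v, 'e, 'k) cochain set" where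
  "B1 G I = {f. (\<forall>as\<in>AP G I 2. Poly_Mapping.keys (f as) \<subseteq>
       {p \<in> nonzero_paths G I. parallel_paths G p (tail G (hd as), as)}) \<and>
     (\<forall>as. as \<notin> AP G I 2 \<longrightarrow> f as = 0)}"

definition delta2 ::
  "('v, 'e) pre_digraph \<Rightarrow> (('v, 'e) qpath \<Rightarrow>\<^sub>0 'k::field) set \<Rightarrow> ('v, 'e, 'k) cochain \<Rightarrow>
   'e \<Rightarrow> 'e \<Rightarrow> 'e \<Rightarrow> (('v, 'e) qpath \<Rightarrow>\<^sub>0 'k)" where
  "delta2 G I f a1 a2 a3 =
     path_class G I (arrow G a1) \<otimes>\<^bsub>quiver_algebra G I\<^esub> f [a2, a3]
     - f [a1, a2] \<otimes>\<^bsub>quiver_algebra G I\<^esub> path_class G I (arrow G a3)"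

definition two_cocycle ::
  "('v, 'e) pre_digraph \<Rightarrow> (('v, 'e) qpath \<Rightarrow>\<^sub>0 'k::field) set \<Rightarrow> ('v, 'e, 'k) cochain \<Rightarrow> bool" where
  "two_cocycle G I f \<longleftrightarrow> (\<forall>a1 a2 a3. [a1, a2, a3] \<in> AP G I 3 \<longrightarrow> delta2 G I f a1 a2 a3 = 0)"

section \<open>The brackets\<close>

text \<open>
  A tensor of paths contributes only if it is a composable sequence of nonzero paths of
  positive length.
\<close>

definition tensor :: "('v, 'e) pre_digraph \<Rightarrow> (('v, 'e) qpath \<Rightarrow>\<^sub>0 'k::field) set \<Rightarrow> ('v, 'e) qpath list \<Rightarrow> bool" where
  "tensor G I ps \<longleftrightarrow> (\<forall>p\<in>set ps. p \<in> nonzero_paths G I \<and> snd p \<noteq> []) \<and>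
     (\<forall>i. Suc i < length ps \<longrightarrow> composable G (ps ! i) (ps ! Suc i))"

type_synonym ('v, 'e, 'k) bimap = "('v, 'e) qpath \<Rightarrow> ('v, 'e) qpath \<Rightarrow> (('v, 'e) qpath \<Rightarrow>\<^sub>0 'k)"

definition gbracket ::
  "('v, 'e, 'k::field) bimap \<Rightarrow> ('v, 'e, 'k) bimap \<Rightarrow>
   ('v, 'e) qpath \<Rightarrow> ('v, 'e) qpath \<Rightarrow> ('v, 'e) qpath \<Rightarrow> (('v, 'e) qpath \<Rightarrow>\<^sub>0 'k)" where
  "gbracket phi psi a b c =
     lin (\<lambda>p. phi p c) (psi a b) - lin (\<lambda>p. phi a p) (psi b c)
     + lin (\<lambda>p. psi p c) (phi a b) - lin (\<lambda>p. psi a p) (phi b c)"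

text \<open>
  \<open>phi G I [f\<^sub>1, \<dots>, f\<^sub>n]\<close> and \<open>vmap G I [f\<^sub>1, \<dots>, f\<^sub>n]\<close> are the maps \<open>\<phi>\<^sub>n\<close> and \<open>v\<^sub>n\<close>.
  List indices start at 0, and \<^term>\<open>nths fs S\<close> keeps the entries with index in \<open>S\<close> in
  increasing order.  An unordered partition of the index set into two nonempty blocks is
  given by its block \<open>S\<close> that contains the first index; the summand does not depend on this choice,
  because \<open>(-1)\<^sup>|\<^sup>S\<^sup>|\<^sup>(\<^sup>n\<^sup>+\<^sup>1\<^sup>)\<close> does not change if \<open>|S|\<close> is replaced by \<open>n - |S|\<close>, and
  \<^const>\<open>gbracket\<close> is symmetric.
\<close>

function phi :: "('v, 'e) pre_digraph \<Rightarrow> (('v, 'e) qpath \<Rightarrow>\<^sub>0 'k::field) set \<Rightarrow>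
      ('v, 'e, 'k) cochain list \<Rightarrow> ('v, 'e, 'k) bimap"
  and vmap :: "('v, 'e) pre_digraph \<Rightarrow> (('v, 'e) qpath \<Rightarrow>\<^sub>0 'k::field) set \<Rightarrow>
      ('v, 'e, 'k) cochain list \<Rightarrow>
      ('v, 'e) qpath \<Rightarrow> ('v, 'e) qpath \<Rightarrow> ('v, 'e) qpath \<Rightarrow> (('v, 'e) qpath \<Rightarrow>\<^sub>0 'k)"
where
  "phi G I fs = (\<lambda>u v.
     let bs = snd u; cs = snd v; zero = zero_rel G I (last bs) (hd cs) in
     if fs = [] \<or> \<not> tensor G I [u, v] then 0
     else if length fs = 1 then
       (if zero then
          path_class G I (fst u, butlast bs) \<otimes>\<^bsub>quiver_algebra G I\<^esub> hd fs [last bs, hd cs]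
            \<otimes>\<^bsub>quiver_algebra G I\<^esub> path_class G I (head G (hd cs), tl cs)
        else 0)
     else
       (if zero \<and> 2 \<le> length bs then
          vmap G I fs (fst u, butlast bs) (arrow G (last bs)) (arrow G (hd cs))
            \<otimes>\<^bsub>quiver_algebra G I\<^esub> path_class G I (head G (hd cs), tl cs)
        else 0)
       - (\<Sum>i = 1..<length cs.
            vmap G I fs u (fst v, take i cs) (arrow G (cs ! i))
              \<otimes>\<^bsub>quiver_algebra G I\<^esub> path_class G I (head G (cs ! i), drop (Suc i) cs)))"
| "vmap G I fs = (\<lambda>a b c.
     if length fs < 2 \<or> \<not> tensor G I [a, b, c] then 0
     else (\<Sum>S\<in>{S. 0 \<in> S \<and> S \<subset> {..<length fs}}.
       scale ((-1) ^ (card S * (length fs + 1) + 1))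
         (gbracket (phi G I (nths fs S)) (phi G I (nths fs ({..<length fs} - S))) a b c)))"
  by pat_completeness auto

lemma length_nths_lt:
  assumes "S \<subseteq> {..<length fs}" "j < length fs" "j \<notin> S"
  shows "length (nths fs S) < length fs"
proof -
  have "{i. i < length fs \<and> i \<in> S} \<subset> {..<length fs}" using assms by auto
  then have "card {i. i < length fs \<and> i \<in> S} < card {..<length fs}"
    by (intro psubset_card_mono) auto
  then show ?thesis by (simp add: length_nths)
qed

termination
proof (relation "measure (\<lambda>x. case x of Inl (G, I, fs) \<Rightarrow> 2 * length fs + 1
    | Inr (G, I, fs) \<Rightarrow> 2 * length fs)", goal_cases)
  case (4 G I fs a b c S)
  then obtain j where "j < length fs" "j \<notin> S" by blast
  then show ?case using 4 length_nths_lt[of S fs j] by auto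
next
  case (5 G I fs a b c S)
  then have "0 < length fs" by auto
  then show ?case using 5 length_nths_lt[of "{..<length fs} - S" fs 0] by auto
qed auto

declare phi.simps [simp del] vmap.simps [simp del]

definition lbracket ::
  "('v, 'e) pre_digraph \<Rightarrow> (('v, 'e) qpath \<Rightarrow>\<^sub>0 'k::field) set \<Rightarrow> ('v, 'e, 'k) cochain list \<Rightarrow>
   'e \<Rightarrow> 'e \<Rightarrow> 'e \<Rightarrow> (('v, 'e) qpath \<Rightarrow>\<^sub>0 'k)" where
  "lbracket G I fs a1 a2 a3 =
     (if length fs = 1 then - delta2 G I (hd fs) a1 a2 a3
      else vmap G I fs (arrow G a1) (arrow G a2) (arrow G a3))"

text \<open>
  \<open>maurer_cartan G I f\<close> is the Maurer-Cartan equation for the formal series \<open>\<Sum>i\<ge>1. f i t\<^sup>i\<close>.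
  A tuple of \<open>n\<close> positive integers with sum \<open>k\<close> exists only for \<open>n \<le> k\<close>, so the sum
  over \<open>n\<close> stops at \<open>k\<close>.
\<close>

definition compositions :: "nat \<Rightarrow> nat \<Rightarrow> nat list set" where
  "compositions n k = {js. length js = n \<and> (\<forall>j\<in>set js. 1 \<le> j) \<and> sum_list js = k}"

lemma compositions_le: "js \<in> compositions n k \<Longrightarrow> n \<le> k"
proof -
  have "(\<forall>j\<in>set js. 1 \<le> j) \<Longrightarrow> length js \<le> sum_list js" for js :: "nat list"
    by (induction js) fastforce+
  then show "js \<in> compositions n k \<Longrightarrow> n \<le> k" by (auto simp: compositions_def)
qed

lemma finite_compositions: "finite (compositions n k)"
proof (rule finite_subset)
  show "compositions n k \<subseteq> {js. set js \<subseteq> {..k} \<and> length js = n}"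
    using member_le_sum_list by (fastforce simp: compositions_def)
qed (simp add: finite_lists_length_eq)

definition maurer_cartan ::
  "('v, 'e) pre_digraph \<Rightarrow> (('v, 'e) qpath \<Rightarrow>\<^sub>0 'k::field_char_0) set \<Rightarrow> (nat \<Rightarrow> ('v, 'e, 'k) cochain) \<Rightarrow> bool" where
  "maurer_cartan G I f \<longleftrightarrow> (\<forall>k\<ge>1. \<forall>a1 a2 a3. [a1, a2, a3] \<in> AP G I 3 \<longrightarrow>
     - delta2 G I (f k) a1 a2 a3
     - (\<Sum>n = 2..k. \<Sum>js\<in>compositions n k.
          scale ((-1) ^ ((n + 1) * n div 2) * (1 / fact n)) (lbracket G I (map f js) a1 a2 a3)) = 0)"

section \<open>Subquivers of the form \<open>(\<star>)\<close>\<close>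

text \<open>\<open>x1, \<dots>, x6\<close> are the vertices \<open>1, \<dots>, 6\<close>, \<open>v\<close> is the path \<open>v'\<close> and \<open>\<delta>s\<close> is the path
  \<open>\<delta>\<^sub>2 \<dots> \<delta>\<^sub>s\<close>.\<close>

definition star_subquiver :: "('v, 'e) pre_digraph \<Rightarrow> (('v, 'e) qpath \<Rightarrow>\<^sub>0 'k::field) set \<Rightarrow> bool" where
  "star_subquiver G I \<longleftrightarrow> (\<exists>x1 x2 x3 x4 x5 x6 \<alpha>1 \<alpha>2 \<alpha>3 \<gamma>1 \<gamma>2 \<rho> \<delta>1 v \<delta>s.
     distinct [x1, x2, x3, x4, x5, x6] \<and> distinct [\<alpha>1, \<alpha>2, \<alpha>3, \<gamma>1, \<gamma>2, \<rho>, \<delta>1] \<and>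
     wf_digraph.arc G \<alpha>1 (x1, x2) \<and> wf_digraph.arc G \<alpha>2 (x2, x3) \<and> wf_digraph.arc G \<alpha>3 (x3, x4) \<and>
     wf_digraph.arc G \<gamma>1 (x2, x5) \<and> wf_digraph.arc G \<gamma>2 (x5, x3) \<and>
     wf_digraph.arc G \<rho> (x5, x6) \<and> wf_digraph.arc G \<delta>1 (x3, x6) \<and>
     pre_digraph.awalk G x1 v x2 \<and> v \<noteq> [\<alpha>1] \<and>
     pre_digraph.awalk G x6 \<delta>s x4 \<and> \<delta>s \<noteq> [] \<and>
     [\<alpha>1, \<alpha>2, \<alpha>3] \<in> AP G I 3 \<and>
     (x1, v) \<in> nonzero_paths G I \<and> (x2, [\<gamma>1, \<gamma>2]) \<in> nonzero_paths G I \<and>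
     (x3, \<delta>1 # \<delta>s) \<in> nonzero_paths G I)"

end

theory Submission
  imports Defs
begin

text \<open>
  The element \<open>\<phi>\<^sub>n(u \<otimes> v)\<close> is a combination of paths that arise from \<open>u v\<close> by exactly \<open>n\<close> rewriting
  steps, where a step replaces a zero relation \<open>a b\<close> by a path in the support of some \<open>f\<^sub>i(a b)\<close>.
  In particular \<open>\<phi>\<^sub>n\<close> vanishes if the junction of \<open>u\<close> and \<open>v\<close> is not a zero relation, and, for
  \<open>n \<ge> 2\<close>, if \<open>u\<close> and \<open>v\<close> are arrows.  Thus for \<open>n \<ge> 3\<close> the bracket \<open>l\<^sub>n\<close> at
  \<open>(\<alpha>\<^sub>1, \<alpha>\<^sub>2, \<alpha>\<^sub>3)\<close> is built from \<open>\<phi>\<^sub>n\<^sub>-\<^sub>1(p \<otimes> \<alpha>\<^sub>3)\<close> and \<open>\<phi>\<^sub>n\<^sub>-\<^sub>1(\<alpha>\<^sub>1 \<otimes> q)\<close> with \<open>p\<close> in the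
  support of \<open>f\<^sub>i(\<alpha>\<^sub>1\<alpha>\<^sub>2)\<close> and \<open>q\<close> in the support of \<open>f\<^sub>i(\<alpha>\<^sub>2\<alpha>\<^sub>3)\<close>.  If all \<open>f\<^sub>i\<close> are cocycles, the
  rewriting of \<open>p \<alpha>\<^sub>3\<close> and of \<open>\<alpha>\<^sub>1 q\<close> either ends after at most one step or is stuck.  For \<open>n = 2\<close>
  the terms of \<open>l\<^sub>2\<close> cancel in pairs.  Hence all \<open>l\<^sub>n\<close> with \<open>n \<ge> 2\<close> vanish on cocycles, and the
  equivalence follows by induction on the power of \<open>t\<close>.
\<close>

section \<open>Walks in acyclic quivers without parallel arrows\<close>

context wf_digraph
begin

lemma awalk_snocD: "awalk u (p @ [a]) v \<Longrightarrow> awalk u p (tail G a) \<and> a \<in> arcs G \<and> v = head G a"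
  by (auto simp: awalk_Cons_iff awalk_Nil_iff)

lemma awalk_hd: "awalk u p v \<Longrightarrow> p \<noteq> [] \<Longrightarrow> hd p \<in> arcs G \<and> tail G (hd p) = u"
  by (cases p) (auto simp: awalk_Cons_iff)

lemma awalk_last: "awalk u p v \<Longrightarrow> p \<noteq> [] \<Longrightarrow> last p \<in> arcs G \<and> head G (last p) = v"
  by (cases p rule: rev_cases) (auto simp: awalk_Cons_iff awalk_Nil_iff)

end

locale acyclic_quiver = nomulti_digraph +
  assumes acyclic: "\<nexists>p. cycle p"
begin

lemma closed_awalk_Nil: "awalk u p u \<Longrightarrow> p = []"
  using acyclic closed_w_imp_cycle by (auto simp: closed_w_def)

lemma awalk_antisym:
  assumes "awalk u p v" "awalk v q u"
  shows "u = v"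
proof -
  have "p @ q = []" using assms by (intro closed_awalk_Nil[of u]) (auto intro: awalk_appendI)
  then show ?thesis using assms by (simp add: awalk_Nil_iff)
qed

lemma parallel_arcs_eq:
  "a \<in> arcs G \<Longrightarrow> b \<in> arcs G \<Longrightarrow> tail G a = tail G b \<Longrightarrow> head G a = head G b \<Longrightarrow> a = b"
  by (rule no_multi_arcs) (simp_all add: arc_to_ends_def)

lemma no_loop: "a \<in> arcs G \<Longrightarrow> tail G a \<noteq> head G a"
  using closed_awalk_Nil[of "tail G a" "[a]"] arc_implies_awalk[of a] by auto

end

section \<open>Rewriting paths\<close>

text \<open>
  \<open>n\<close> counts the replacements of a zero relation \<open>a c\<close> by an element of \<open>T a c\<close>; the order of the
  steps follows the recursion for \<open>\<phi>\<^sub>n\<close>: the arrows of \<open>v\<close> are multiplied to \<open>u\<close> one at a time.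
\<close>

inductive reduces for N :: "'e \<Rightarrow> 'e \<Rightarrow> bool" and T :: "'e \<Rightarrow> 'e \<Rightarrow> 'e list set" where
  Nil: "reduces N T u [] 0 u"
| Start: "reduces N T [c] v n w \<Longrightarrow> reduces N T [] (c # v) n w"
| Extend: "N a c \<Longrightarrow> reduces N T (u @ [a, c]) v n w \<Longrightarrow> reduces N T (u @ [a]) (c # v) n w"
| Reduce: "s \<in> T a c \<Longrightarrow> reduces N T u s k x \<Longrightarrow> reduces N T x v l w \<Longrightarrow>
    reduces N T (u @ [a]) (c # v) (Suc (k + l)) w"

inductive_cases reduces_NilE: "reduces N T u [] n w"
inductive_cases reduces_ConsE: "reduces N T (u @ [a]) (c # v) n w"

lemma reduces_append:
  assumes "reduces N T u v n x" "reduces N T x v' n' w"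
  shows "reduces N T u (v @ v') (n + n') w"
  using assms
proof (induction rule: reduces.induct)
  case (Reduce s a c u k y v l w')
  then have "reduces N T (u @ [a]) (c # v @ v') (Suc (k + (l + n'))) w"
    by (auto intro: reduces.Reduce)
  then show ?case by (simp add: add.assoc)
qed (auto intro: reduces.intros)

text \<open>Arrows of the second argument are consumed from left to right, and a replacement path is
  consumed completely before the next arrow. Hence every prefix of the second argument marks an
  intermediate state.\<close>

lemma reduces_appendE:
  assumes "reduces N T u (v @ v') n w"
  obtains n1 n2 x where "reduces N T u v n1 x" "reduces N T x v' n2 w" "n = n1 + n2"
proof -
  have "\<exists>n1 n2 x. reduces N T u v n1 x \<and> reduces N T x v' n2 w \<and> n = n1 + n2"
    using assms
  proof (induction u "v @ v'" n w arbitrary: v rule: reduces.induct)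
    case (Nil u)
    then show ?case by (auto intro: reduces.intros)
  next
    case (Start c t n w)
    show ?case
    proof (cases v)
      case Nil
      then show ?thesis using Start by (metis add_0 append_Nil reduces.Nil reduces.Start)
    next
      case (Cons c' v1)
      then show ?thesis using Start.hyps(2)[of v1] Start.hyps(3) by (auto intro: reduces.Start)
    qed
  next
    case (Extend a c u t n w)
    show ?case
    proof (cases v)
      case Nil
      then show ?thesis using Extend by (metis add_0 append_Nil reduces.Nil reduces.Extend)
    next
      case (Cons c' v1)
      then show ?thesis using Extend.hyps(1) Extend.hyps(3)[of v1] Extend.hyps(4)
        by (auto intro: reduces.Extend)
    qed
  next
    case (Reduce s a c u k x t l w)
    show ?case
    proof (cases v)
      case Nil
      then show ?thesis using Reduce by (metis add_0 append_Nil reduces.Nil reduces.Reduce)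
    next
      case (Cons c' v1)
      then obtain n1 n2 y where "reduces N T x v1 n1 y" "reduces N T y v' n2 w" "l = n1 + n2"
        using Reduce.hyps(5)[of v1] Reduce.hyps(6) by auto
      moreover from this have "reduces N T (u @ [a]) (c # v1) (Suc (k + n1)) y"
        using Reduce.hyps by (auto intro: reduces.Reduce)
      ultimately show ?thesis using Cons Reduce.hyps(6)
        by (intro exI[of _ "Suc (k + n1)"] exI[of _ n2] exI[of _ y]) auto
    qed
  qed
  then show ?thesis using that by blast
qed

text \<open>Ordinary multiplication is the case without replacements; this accounts for the trailing
  factors in \<open>phi\<close>.\<close>

lemma reduces_product: "successively N (u @ v) \<Longrightarrow> reduces N T u v 0 (u @ v)"
proof (induction v arbitrary: u)
  case Nil
  then show ?case by (simp add: reduces.Nil)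
next
  case (Cons c v)
  show ?case
  proof (cases u rule: rev_cases)
    case Nil
    then show ?thesis using Cons.IH[of "[c]"] Cons.prems by (auto intro: reduces.Start)
  next
    case (snoc u' a)
    have "reduces N T (u' @ [a, c]) v 0 (u' @ [a, c] @ v)"
      using Cons.IH[of "u' @ [a, c]"] Cons.prems snoc by simp
    moreover have "N a c" using Cons.prems snoc by (auto simp: successively_append_iff)
    ultimately show ?thesis using snoc by (auto intro: reduces.Extend)
  qed
qed

text \<open>\<open>T a b\<close> stands for the paths that cocycles can put in place of the zero
  relation \<open>a b\<close>. The last two assumptions extract what is used of the cocycle
  equation: a path in \<open>T a b\<close> that does not end with \<open>b\<close> stays nonzero
  when followed by \<open>c\<close>, so the equation forces it to start with \<open>a\<close>;
  dually on the right.\<close>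

locale gentle_rewriting = acyclic_quiver G
  for G :: "('v, 'e) pre_digraph" (structure) +
  fixes N Z :: "'e \<Rightarrow> 'e \<Rightarrow> bool" and T :: "'e \<Rightarrow> 'e \<Rightarrow> 'e list set"
  assumes NZ: "N a b \<or> Z a b \<longleftrightarrow> a \<in> arcs G \<and> b \<in> arcs G \<and> head G a = tail G b"
    and disjoint: "N a b \<Longrightarrow> \<not> Z a b"
    and N_unique: "N a b \<Longrightarrow> N a b' \<Longrightarrow> b = b'" "N a b \<Longrightarrow> N a' b \<Longrightarrow> a = a'"
    and Z_unique: "Z a b \<Longrightarrow> Z a b' \<Longrightarrow> b = b'" "Z a b \<Longrightarrow> Z a' b \<Longrightarrow> a = a'"
    and T_Z: "s \<in> T a b \<Longrightarrow> Z a b"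
    and T_path: "s \<in> T a b \<Longrightarrow> successively N s" "s \<in> T a b \<Longrightarrow> awalk (tail G a) s (head G b)"
    and cocycle_left: "Z a b \<Longrightarrow> Z b c \<Longrightarrow> s \<in> T a b \<Longrightarrow> hd s = a \<or> last s = b"
    and cocycle_right: "Z a b \<Longrightarrow> Z b c \<Longrightarrow> s \<in> T b c \<Longrightarrow> hd s = b \<or> last s = c"
begin

section \<open>Basic facts on rewriting: end points and nonvanishing\<close>

lemma N_D: "N a b \<Longrightarrow> a \<in> arcs G" "N a b \<Longrightarrow> b \<in> arcs G" "N a b \<Longrightarrow> head G a = tail G b"
  and Z_D: "Z a b \<Longrightarrow> a \<in> arcs G" "Z a b \<Longrightarrow> b \<in> arcs G" "Z a b \<Longrightarrow> head G a = tail G b"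
  using NZ by blast+

lemma not_N: "a \<in> arcs G \<Longrightarrow> b \<in> arcs G \<Longrightarrow> head G a = tail G b \<Longrightarrow> \<not> N a b \<Longrightarrow> Z a b"
  and not_Z: "a \<in> arcs G \<Longrightarrow> b \<in> arcs G \<Longrightarrow> head G a = tail G b \<Longrightarrow> \<not> Z a b \<Longrightarrow> N a b"
  using NZ by blast+

text \<open>A trivial path in \<open>T a b\<close> would make \<open>a b\<close> an oriented
  cycle.\<close>

lemma T_nonempty: "s \<in> T a b \<Longrightarrow> s \<noteq> []"
proof
  assume s: "s \<in> T a b" "s = []"
  then have "Z a b" "tail G a = head G b"
    using T_Z[of s a b] T_path(2)[of s a b] by (simp_all add: awalk_Nil_iff)
  then have "awalk (tail G a) [a, b] (tail G a)"
    using Z_D[of a b] by (auto simp: awalk_Cons_iff awalk_Nil_iff)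
  then show False using closed_awalk_Nil by blast
qed

text \<open>A replacement path is parallel to the relation it replaces, and a step without
  replacement only joins arrows related by \<open>N\<close>.\<close>

lemma reduces_path:
  assumes "reduces N T u v n w" "successively N u" "successively N v" "awalk x u y" "awalk y v z"
  shows "successively N w \<and> awalk x w z"
  using assms
proof (induction arbitrary: x y z rule: reduces.induct)
  case (Nil u)
  then show ?case by (simp add: awalk_Nil_iff)
next
  case (Start c v n w)
  then show ?case
    by (auto simp: awalk_Cons_iff awalk_Nil_iff successively_Cons intro!: Start.IH)
next
  case (Extend a c u v n w)
  show ?case
    by (rule Extend.IH) (use Extend in \<open>auto simp: awalk_Cons_iff awalk_Nil_iff successively_Cons successively_append_iff\<close>)
next
  case (Reduce s a c u k x' v l w)
  have "successively N x' \<and> awalk x x' (head G c)"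
    by (rule Reduce.IH(1)[where y = "tail G a"])
      (use Reduce T_path[of s a c] in \<open>auto simp: awalk_Cons_iff awalk_Nil_iff successively_append_iff\<close>)
  then show ?case
    by (intro Reduce.IH(2)[where y = "head G c"])
      (use Reduce in \<open>auto simp: awalk_Cons_iff awalk_Nil_iff successively_Cons\<close>)
qed

lemma reduces_N:
  assumes "reduces N T u v n w" "successively N (u @ v)"
  shows "n = 0" "w = u @ v"
proof -
  have "n = 0 \<and> w = u @ v"
    using assms
  proof (induction rule: reduces.induct)
    case (Reduce s a c u k x v l w)
    then have "N a c" by (auto simp: successively_append_iff)
    then show ?case using T_Z Reduce.hyps(1) disjoint by blast
  qed auto
  then show "n = 0" "w = u @ v" by auto
qed

lemma reduces_ZE:
  assumes "reduces N T (u @ [a]) (c # v) n w" "Z a c"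
  obtains s k l x where "s \<in> T a c" "reduces N T u s k x" "reduces N T x v l w" "n = Suc (k + l)"
  using assms(1)
proof (rule reduces_ConsE)
  assume "N a c"
  then show thesis using assms(2) disjoint by blast
qed (use that in auto)

lemma successively_awalk:
  "successively N es \<Longrightarrow> es \<noteq> [] \<Longrightarrow> set es \<subseteq> arcs G \<Longrightarrow> awalk (tail G (hd es)) es (head G (last es))"
  by (induction es rule: induct_list012) (auto simp: awalk_Cons_iff awalk_Nil_iff N_D)

section \<open>Rewriting that gets stuck, and the resulting bounds on the number of steps\<close>

text \<open>
  By the cocycle conditions no zero relation ends in \<open>a\<close>, since the paths in \<open>T a b\<close> neither start
  with \<open>a\<close> nor end with \<open>b\<close>.  So \<open>a'\<close> is the only arrow into the source of \<open>a\<close>, and a path from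
  the source of \<open>u @ [a']\<close> followed by an arrow of \<open>s\<close> always has a zero relation at the junction.
  At the last arrow of \<open>s\<close> this zero relation overlaps the one with \<open>b'\<close>, and there the cocycle
  conditions admit no replacement.
\<close>

lemma dead_end:
  assumes u: "successively N (u @ [a', a])" "set u \<subseteq> arcs G" and ab: "Z a b" and bb': "N b b'"
    and start: "\<And>s. s \<in> T a b \<Longrightarrow> hd s \<noteq> a"
    and unreach: "\<And>c p. N c b \<Longrightarrow> \<not> awalk (tail G a) p (tail G c)"
    and s: "s \<in> T a b"
  shows "\<not> reduces N T (u @ [a']) s n w"
proof
  define x0 where "x0 = tail G (hd (u @ [a']))"
  have a'a: "N a' a" and u': "successively N (u @ [a'])" using u by (auto simp: successively_append_iff)
  have x0: "awalk x0 (u @ [a']) (tail G a)"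
    using successively_awalk[OF u'] u(2) N_D[OF a'a] by (simp add: x0_def)
  note s_path = T_path[OF s] and s_ne = T_nonempty[OF s]
  \<comment> \<open>If \<open>s\<close> ended with \<open>b\<close>, the arrow \<open>c\<close>
    before it would satisfy \<open>N c b\<close> and be reachable from the source of
    \<open>a\<close>, against \<open>unreach\<close>; if \<open>s\<close> were \<open>b\<close>
    alone, \<open>a\<close> would be a loop.\<close>
  have last_s: "last s \<noteq> b"
  proof
    assume "last s = b"
    then obtain s0 where s0: "s = s0 @ [b]" using s_ne by (metis append_butlast_last_id)
    then have w: "awalk (tail G a) s0 (tail G b)" using s_path(2) awalk_snocD by blast
    show False
    proof (cases s0 rule: rev_cases)
      case Nil
      then show False using w Z_D[OF ab] no_loop[of a] by (auto simp: awalk_Nil_iff)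
    next
      case (snoc s1 c)
      then have "N c b" using s_path(1) s0 by (auto simp: successively_append_iff)
      moreover have "awalk (tail G a) s1 (tail G c)" using w snoc awalk_snocD by blast
      ultimately show False using unreach by blast
    qed
  qed
  \<comment> \<open>\<open>Z c a\<close> would make \<open>cocycle_right\<close> applicable to
    \<open>c a\<close> and \<open>a b\<close>, but \<open>s\<close> neither starts with
    \<open>a\<close> nor ends with \<open>b\<close>.\<close>
  have into_a: "c = a'" if "c \<in> arcs G" "head G c = tail G a" for c
  proof -
    have "\<not> Z c a" using cocycle_right[of c a b s] ab s start[OF s] last_s by blast
    then have "N c a" using that not_N Z_D(1)[OF ab] by blast
    then show ?thesis using N_unique(2) a'a by blast
  qed
  have s_take: "awalk (tail G a) (take i s) (tail G (s ! i))" if "i < length s" for i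
  proof -
    have "awalk (tail G a) (take i s @ s ! i # drop (Suc i) s) (head G b)"
      using s_path(2) that by (simp add: id_take_nth_drop[symmetric])
    then show ?thesis by (auto simp: awalk_Cons_iff)
  qed
  have s_N: "N (s ! i) (s ! Suc i)" if "Suc i < length s" for i
    using s_path(1) that by (auto simp: successively_conv_nth)
  \<comment> \<open>An invariant of all intermediate states \<open>y\<close>, whatever replacements
    produced them. If \<open>y\<close> could be continued by \<open>s ! Suc j\<close>, it would end
    with \<open>s ! j\<close>, and the zero relation found at \<open>s ! j\<close> would lie inside
    the nonzero path \<open>y\<close>.\<close>
  have junction: "y \<noteq> [] \<and> Z (last y) (s ! i)"
    if "i < length s" "successively N y" "awalk x0 y (tail G (s ! i))" for i y
    using that
  proof (induction i arbitrary: y)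
    case prems: 0
    have ends: "s ! 0 = hd s" "tail G (hd s) = tail G a" "hd s \<in> arcs G"
      using s_ne awalk_hd[OF s_path(2)] by (auto simp: hd_conv_nth)
    have "y \<noteq> []"
      using prems x0 ends closed_awalk_Nil[of x0 "u @ [a']"] by (auto simp: awalk_Nil_iff)
    moreover from this have "last y \<in> arcs G" "head G (last y) = tail G (hd s)"
      using awalk_last prems ends by auto
    moreover from this have "last y = a'" using into_a ends by simp
    moreover have "\<not> N a' (hd s)" using N_unique(1) a'a start[OF s] by blast
    ultimately show ?case using not_N ends by metis
  next
    case (Suc j)
    have N: "N (s ! j) (s ! Suc j)" using s_N Suc.prems(1) by blast
    have ne: "y \<noteq> []"
    proof
      assume "y = []"
      then have "awalk (tail G a) (take (Suc j) s) x0"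
        using Suc.prems s_take[of "Suc j"] by (auto simp: awalk_Nil_iff)
      then have "awalk x0 ((u @ [a']) @ take (Suc j) s) x0" using x0 awalk_appendI by blast
      then show False using closed_awalk_Nil by blast
    qed
    moreover have "\<not> N (last y) (s ! Suc j)"
    proof
      assume "N (last y) (s ! Suc j)"
      then have "last y = s ! j" using N N_unique(2) by blast
      then obtain y' where y': "y = y' @ [s ! j]" using ne by (metis append_butlast_last_id)
      then have "y' \<noteq> [] \<and> Z (last y') (s ! j)"
        using Suc awalk_snocD[of x0 y'] by (auto simp: successively_append_iff)
      moreover from this have "N (last y') (s ! j)"
        using Suc.prems(2) y' by (auto simp: successively_append_iff)
      ultimately show False using disjoint by blast
    qed
    ultimately show ?case
      using not_N awalk_last[OF Suc.prems(3) ne] N_D(2)[OF N] by blast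
  qed
  have Z_last: "Z (last s) b'"
  proof -
    have "last s \<in> arcs G" "head G (last s) = head G b" using awalk_last[OF s_path(2) s_ne] by auto
    moreover have "\<not> N (last s) b'" using N_unique(2) bb' last_s by blast
    ultimately show ?thesis using not_N N_D[OF bb'] by simp
  qed
  \<comment> \<open>Every remaining arrow of \<open>s\<close> costs a replacement. The induction is
    on the number of steps and not on the position, since a replacement that ends with the last
    arrow of \<open>s\<close> leads back to the same position with fewer steps left.\<close>
  have stuck: "\<not> reduces N T y (drop i s) n w"
    if "i < length s" "successively N y" "awalk x0 y (tail G (s ! i))" for i y n w
    using that
  proof (induction n arbitrary: y i w rule: less_induct)
    case (less n)
    define \<sigma> where "\<sigma> = s ! i"
    obtain y' \<kappa> where y: "y = y' @ [\<kappa>]" and Z\<kappa>: "Z \<kappa> \<sigma>"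
      using junction[OF less.prems] unfolding \<sigma>_def by (metis append_butlast_last_id)
    have y': "successively N y'" "awalk x0 y' (tail G \<kappa>)"
      using less.prems y awalk_snocD[of x0 y' \<kappa>] by (auto simp: successively_append_iff)
    have d: "drop i s = \<sigma> # drop (Suc i) s" using less.prems(1) by (simp add: Cons_nth_drop_Suc \<sigma>_def)
    show ?case
    proof
      assume "reduces N T y (drop i s) n w"
      then obtain z k l x where z: "z \<in> T \<kappa> \<sigma>" and k: "reduces N T y' z k x"
        and l: "reduces N T x (drop (Suc i) s) l w" and n: "n = Suc (k + l)"
        unfolding y d using Z\<kappa> by (rule reduces_ZE)
      note z_path = T_path[OF z]
      have x: "successively N x" "awalk x0 x (head G \<sigma>)"
        using reduces_path[OF k y'(1) z_path(1) y'(2) z_path(2)] by auto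
      show False
      proof (cases "Suc i < length s")
        case True
        then have "head G \<sigma> = tail G (s ! Suc i)" using s_N[of i] N_D(3) by (auto simp: \<sigma>_def)
        then show False using less.IH[of l "Suc i" x w] True x l n by auto
      next
        case False
        then have "i = length s - 1" using less.prems(1) by simp
        then have last: "\<sigma> = last s" "drop i s = [\<sigma>]" "Z \<sigma> b'"
          using d s_ne Z_last by (auto simp: \<sigma>_def last_conv_nth)
        have z_ne: "z \<noteq> []" by (rule T_nonempty[OF z])
        show False
        proof (cases "last z = \<sigma>")
          case True
          then obtain z' where z': "z = z' @ [\<sigma>]" using z_ne by (metis append_butlast_last_id)
          then obtain k1 k2 x1 where k1: "reduces N T y' z' k1 x1"
            and k2: "reduces N T x1 [\<sigma>] k2 x" and kk: "k = k1 + k2"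
            using k by (auto elim: reduces_appendE)
          have "successively N x1 \<and> awalk x0 x1 (tail G \<sigma>)"
            using reduces_path[OF k1 y'(1) _ y'(2), of "tail G \<sigma>"] z_path z' awalk_snocD[of _ z' \<sigma>]
            by (auto simp: successively_append_iff)
          then show False using less.IH[of k2 i x1 x] less.prems(1) k2 kk n last by (auto simp: \<sigma>_def)
        next
          case False
          \<comment> \<open>Now \<open>z\<close> starts with \<open>\<kappa>\<close>, and its last
            arrow continues nonzero into \<open>b'\<close>, hence is \<open>b\<close>. So
            \<open>take i s\<close> followed by the inner part of \<open>z\<close> leads from the
            source of \<open>a\<close> to the source of an arrow before \<open>b\<close>, against
            \<open>unreach\<close>.\<close>
          then have hd: "hd z = \<kappa>" using cocycle_left[OF Z\<kappa> last(3) z] by blast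
          have "last z \<in> arcs G" "head G (last z) = tail G b'"
            using awalk_last[OF z_path(2) z_ne] Z_D[OF last(3)] by auto
          moreover have "\<not> Z (last z) b'" using Z_unique(2) last(3) False by blast
          ultimately have "N (last z) b'" using not_N N_D(2)[OF bb'] by blast
          then have lz: "last z = b" using N_unique(2) bb' by blast
          obtain z1 where z1: "z = \<kappa> # z1" using hd z_ne by (cases z) auto
          have w1: "awalk (tail G \<sigma>) z1 (head G \<sigma>)"
            using z_path(2) Z_D(3)[OF Z\<kappa>] unfolding z1 by (auto simp: awalk_Cons_iff)
          then have "z1 \<noteq> []" using no_loop Z_D(2)[OF Z\<kappa>] by (auto simp: awalk_Nil_iff)
          then obtain z2 where z2: "z1 = z2 @ [b]" using lz z1 by (metis append_butlast_last_id last_ConsR)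
          then have w2: "awalk (tail G \<sigma>) z2 (tail G b)" "head G b = head G \<sigma>"
            using w1 awalk_snocD by (blast, metis w1 awalk_snocD)
          show False
          proof (cases z2 rule: rev_cases)
            case Nil
            then have "\<sigma> = b"
              using w2 parallel_arcs_eq[of \<sigma> b] Z_D(2)[OF Z\<kappa>] Z_D(2)[OF ab] by (auto simp: awalk_Nil_iff)
            then show False using last_s last by simp
          next
            case (snoc z3 c)
            then have "N c b" using z_path(1) z1 z2 by (auto simp: successively_append_iff successively_Cons)
            moreover have "awalk (tail G \<sigma>) z3 (tail G c)" using w2 snoc awalk_snocD by blast
            moreover have "awalk (tail G a) (take i s) (tail G \<sigma>)"
              using s_take less.prems(1) by (simp add: \<sigma>_def)
            ultimately show False using unreach awalk_appendI by blast
          qed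
        qed
      qed
    qed
  qed
  assume "reduces N T (u @ [a']) s n w"
  moreover have "awalk x0 (u @ [a']) (tail G (s ! 0))"
    using x0 awalk_hd[OF s_path(2) s_ne] s_ne by (simp add: hd_conv_nth)
  ultimately show False using stuck[of 0 "u @ [a']" n w] u' s_ne by simp
qed

text \<open>If \<open>p\<close> does not end with \<open>a2\<close>, then \<open>p\<close> followed
  by \<open>a3\<close> is nonzero. Otherwise \<open>a2 a3\<close> is replaced by some
  \<open>s\<close>. If \<open>s\<close> starts with \<open>a2\<close>, the result is nonzero as it
  stands. If not, \<open>s\<close> ends with \<open>a3\<close> by the cocycle condition, the rest of
  \<open>s\<close> is parallel to \<open>a2\<close>, and the next junction is a zero relation at
  which \<open>dead_end\<close> applies.\<close>

lemma reduces_left: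
  assumes Z: "Z a1 a2" "Z a2 a3" and p: "p \<in> T a1 a2" and red: "reduces N T p [a3] n w"
  shows "n \<le> 1"
proof (cases "last p = a2")
  case False
  note p_ne = T_nonempty[OF p]
  have "last p \<in> arcs G" "head G (last p) = tail G a3"
    using awalk_last[OF T_path(2)[OF p] p_ne] Z_D[OF Z(2)] by auto
  then have "N (last p) a3" using not_Z Z_unique(2) Z(2) False Z_D by blast
  then have "successively N (p @ [a3])" using T_path(1)[OF p] by (auto simp: successively_append_iff)
  then show ?thesis using reduces_N red by fastforce
next
  case True
  then obtain p' where p': "p = p' @ [a2]" using T_nonempty[OF p] by (metis append_butlast_last_id)
  obtain s k where s: "s \<in> T a2 a3" and k: "reduces N T p' s k w" and n: "n = Suc k"
    using reduces_ZE[OF red[unfolded p'] Z(2)] by (metis add_0_right reduces_NilE)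
  have w': "awalk (tail G a1) p' (tail G a2)" using T_path(2)[OF p] p' awalk_snocD by blast
  then have "p' \<noteq> []" using no_loop[of a1] Z_D[OF Z(1)] by (auto simp: awalk_Nil_iff)
  then obtain u a where u: "p' = u @ [a]" by (metis append_butlast_last_id)
  have a: "N a a2" "successively N p'" "set p' \<subseteq> arcs G"
    using T_path(1)[OF p] w' p' u by (auto simp: successively_append_iff)
  show ?thesis
  proof (cases "hd s = a2")
    case True
    then have "successively N (p' @ s)"
      using a u T_path(1)[OF s] by (auto simp: successively_append_iff successively_Cons)
    then show ?thesis using reduces_N(1)[OF k] n by simp
  next
    case False
    then have "last s = a3" using cocycle_right Z s by blast
    then obtain s2 where s2: "s = s2 @ [a3]" using T_nonempty[OF s] by (metis append_butlast_last_id)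
    then have ws: "awalk (tail G a2) s2 (head G a2)"
      using T_path(2)[OF s] awalk_snocD Z_D[OF Z(2)] by metis
    then have "s2 \<noteq> []" using no_loop[of a2] Z_D[OF Z(2)] by (auto simp: awalk_Nil_iff)
    then obtain b s3 where b: "s2 = b # s3" by (cases s2) auto
    have ba2: "b \<noteq> a2" using False b s2 by simp
    have wb: "b \<in> arcs G" "tail G b = tail G a2" "awalk (head G b) s3 (head G a2)"
      using ws b by (auto simp: awalk_Cons_iff)
    \<comment> \<open>If \<open>b\<close> alone made up \<open>s2\<close>, it would be parallel to
      \<open>a2\<close>.\<close>
    have "s3 \<noteq> []" using parallel_arcs_eq[of b a2] wb Z_D[OF Z(2)] ba2 by (auto simp: awalk_Nil_iff)
    then obtain b' where bb': "N b b'"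
      using T_path(1)[OF s] s2 b by (cases s3) (auto simp: successively_Cons)
    have ab: "Z a b" using not_N N_D[OF a(1)] wb N_unique(1)[OF a(1)] ba2 by metis
    have wa: "awalk (tail G a1) u (tail G a)" using w' u awalk_snocD by blast
    have aa1: "a \<noteq> a1" using disjoint a(1) Z(1) by blast
    \<comment> \<open>As \<open>a\<close> ends where \<open>a1\<close> does, it must start
      elsewhere. This yields the arrow \<open>a'\<close> before \<open>a\<close>, and is used again
      for unreachability.\<close>
    have tails: "tail G a \<noteq> tail G a1"
      using parallel_arcs_eq[of a a1] aa1 N_D[OF a(1)] Z_D[OF Z(1)] by auto
    then have "u \<noteq> []" using wa by (auto simp: awalk_Nil_iff)
    then obtain u1 a' where u1: "u = u1 @ [a']" by (metis append_butlast_last_id)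
    have p'_eq: "p' = (u1 @ [a']) @ [a]" and s_eq: "s = b # s3 @ [a3]" using u u1 s2 b by auto
    obtain z k' x where z: "z \<in> T a b" "reduces N T (u1 @ [a']) z k' x"
      using reduces_ZE[OF k[unfolded p'_eq s_eq] ab] by metis
    moreover have "\<not> reduces N T (u1 @ [a']) z k' x"
    proof (rule dead_end[OF _ _ ab bb' _ _ z(1)])
      show "successively N (u1 @ [a', a])" "set u1 \<subseteq> arcs G" using a u u1 by auto
    next
      fix z assume z: "z \<in> T a b"
      \<comment> \<open>Otherwise \<open>z\<close> continues with \<open>a2\<close>, the only
        nonzero successor of \<open>a\<close>. Together with \<open>s3\<close> this gives walks both
        ways between the heads of \<open>a2\<close> and \<open>b\<close>, so the two arrows are
        parallel.\<close>
      show "hd z \<noteq> a"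
      proof
        assume "hd z = a"
        then obtain z1 where z1: "z = a # z1" using T_nonempty[OF z] by (cases z) auto
        then have w1: "awalk (head G a) z1 (head G b)" using T_path(2)[OF z] by (auto simp: awalk_Cons_iff)
        then have "z1 \<noteq> []" using no_loop[of b] Z_D[OF ab] by (auto simp: awalk_Nil_iff)
        then obtain z2 where "z1 = a2 # z2"
          using T_path(1)[OF z] z1 a(1) N_unique(1) by (cases z1) (auto simp: successively_Cons)
        then have "awalk (head G a2) z2 (head G b)" using w1 by (auto simp: awalk_Cons_iff)
        then have "head G b = head G a2" using awalk_antisym wb by blast
        then show False using parallel_arcs_eq[of b a2] wb ba2 Z_D[OF Z(2)] by blast
      qed
    next
      fix c q assume c: "N c b"
      \<comment> \<open>\<open>a1 a2\<close> is the only zero relation starting with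
        \<open>a1\<close>, so \<open>a1\<close> is the arrow that precedes \<open>b\<close>. A walk
        from the source of \<open>a\<close> to that of \<open>a1\<close> would close up with
        \<open>u\<close>.\<close>
      have "N a1 b" using not_Z Z_D[OF Z(1)] wb Z_unique(1)[OF Z(1)] ba2 by metis
      then have "c = a1" using c N_unique(2) by blast
      then show "\<not> awalk (tail G a) q (tail G c)" using awalk_antisym wa tails by blast
    qed
    ultimately show ?thesis by blast
  qed
qed

text \<open>Dual to \<open>reduces_left\<close> in content but not formally, because rewriting
  proceeds from the left. The relation \<open>a1 a2\<close> is replaced first, and the critical
  junction is the one between the last arrow \<open>a\<close> of the replacement and the arrow
  \<open>b\<close> after \<open>a2\<close> in \<open>q\<close>.\<close>

lemma reduces_right:
  assumes Z: "Z a1 a2" "Z a2 a3" and q: "q \<in> T a2 a3" and red: "reduces N T [a1] q n w"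
  shows "n \<le> 1"
proof (cases "hd q = a2")
  case False
  note q_ne = T_nonempty[OF q]
  have "hd q \<in> arcs G" "tail G (hd q) = head G a1"
    using awalk_hd[OF T_path(2)[OF q] q_ne] Z_D[OF Z(1)] by auto
  then have "N a1 (hd q)" using not_Z Z_unique(1) Z(1) False Z_D by metis
  then have "successively N ([a1] @ q)" using T_path(1)[OF q] by (auto simp: successively_Cons)
  then show ?thesis using reduces_N red by fastforce
next
  case True
  then obtain q' where q': "q = a2 # q'" using T_nonempty[OF q] by (cases q) auto
  \<comment> \<open>Nothing stands to the left of \<open>a1\<close>, so the replacement
    \<open>s\<close> is taken over unchanged and only \<open>q'\<close> can cost further
    steps.\<close>
  obtain s l where s: "s \<in> T a1 a2" and l: "reduces N T s q' l w" and n: "n = Suc l"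
    using reduces_ZE[of "[]" a1 a2 q' n w] red Z(1) T_path(1) reduces_N[of "[]"]
    unfolding q' by (metis add_0 append_Nil)
  have w': "awalk (head G a2) q' (head G a3)" using T_path(2)[OF q] q' by (auto simp: awalk_Cons_iff)
  then have "q' \<noteq> []" using no_loop[of a3] Z_D[OF Z(2)] by (auto simp: awalk_Nil_iff)
  then obtain b q2 where b: "q' = b # q2" by (cases q') auto
  have Nb: "N a2 b" using T_path(1)[OF q] q' b by (auto simp: successively_Cons)
  have wb: "b \<in> arcs G" "tail G b = tail G a3" "awalk (head G b) q2 (head G a3)"
    using w' b Z_D[OF Z(2)] by (auto simp: awalk_Cons_iff)
  have ba3: "b \<noteq> a3" using Nb Z(2) disjoint by blast
  note s_ne = T_nonempty[OF s]
  show ?thesis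
  proof (cases "last s = a2")
    case True
    then have "successively N (s @ q')"
      using T_path(1)[OF q] T_path(1)[OF s] Nb q' b by (auto simp: successively_append_iff successively_Cons)
    then show ?thesis using reduces_N(1)[OF l] n by simp
  next
    case False
    then have "hd s = a1" using cocycle_left Z s by blast
    then obtain s1 where s1: "s = a1 # s1" using s_ne by (cases s) auto
    then have w1: "awalk (tail G a2) s1 (head G a2)"
      using T_path(2)[OF s] Z_D[OF Z(1)] by (auto simp: awalk_Cons_iff)
    then have "s1 \<noteq> []" using no_loop[of a2] Z_D[OF Z(2)] by (auto simp: awalk_Nil_iff)
    then obtain s2 a where s2: "s1 = s2 @ [a]" by (metis append_butlast_last_id)
    then have wa: "awalk (tail G a2) s2 (tail G a)" "a \<in> arcs G" "head G a = head G a2"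
      using w1 awalk_snocD by metis+
    have aa2: "a \<noteq> a2" using False s1 s2 by simp
    have ab: "Z a b" using not_N wa wb N_D[OF Nb] N_unique(2)[OF Nb] aa2 by metis
    have Na3: "N a a3" using not_Z wa Z_D[OF Z(2)] Z_unique(2)[OF Z(2)] aa2 by metis
    have tails: "tail G a \<noteq> tail G a2" using parallel_arcs_eq[of a a2] aa2 wa Z_D[OF Z(2)] by auto
    have "q2 \<noteq> []" using parallel_arcs_eq[of b a3] wb Z_D[OF Z(2)] ba3 by (auto simp: awalk_Nil_iff)
    then obtain b' where bb': "N b b'"
      using T_path(1)[OF q] q' b by (cases q2) (auto simp: successively_Cons)
    \<comment> \<open>Here \<open>a1\<close> itself guarantees that an arrow precedes
      \<open>a\<close> in \<open>s\<close>.\<close>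
    obtain u1 a' where u1: "a1 # s2 = u1 @ [a']" by (metis append_butlast_last_id list.distinct(1))
    then have s_eq: "s = (u1 @ [a']) @ [a]" using s1 s2 by simp
    have u1_set: "set u1 \<subseteq> arcs G" using T_path(2)[OF s] s_eq by auto
    obtain z k' x where z: "z \<in> T a b" "reduces N T (u1 @ [a']) z k' x"
      using reduces_ZE[OF l[unfolded s_eq b] ab] by metis
    moreover have "\<not> reduces N T (u1 @ [a']) z k' x"
    proof (rule dead_end[OF _ u1_set ab bb' _ _ z(1)])
      show "successively N (u1 @ [a', a])" using T_path(1)[OF s] s_eq by simp
    next
      fix z assume z: "z \<in> T a b"
      show "hd z \<noteq> a"
      proof
        assume "hd z = a"
        then obtain z1 where z1: "z = a # z1" using T_nonempty[OF z] by (cases z) auto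
        then have w1: "awalk (head G a) z1 (head G b)" using T_path(2)[OF z] by (auto simp: awalk_Cons_iff)
        then have "z1 \<noteq> []" using no_loop[of b] Z_D[OF ab] by (auto simp: awalk_Nil_iff)
        then obtain z2 where "z1 = a3 # z2"
          using T_path(1)[OF z] z1 Na3 N_unique(1) by (cases z1) (auto simp: successively_Cons)
        then have "awalk (head G a3) z2 (head G b)" using w1 by (auto simp: awalk_Cons_iff)
        then have "head G b = head G a3" using awalk_antisym wb by blast
        then show False using parallel_arcs_eq[of b a3] wb ba3 Z_D[OF Z(2)] by blast
      qed
    next
      fix c p assume "N c b"
      then have "c = a2" using Nb N_unique(2) by blast
      then show "\<not> awalk (tail G a) p (tail G c)" using awalk_antisym wa tails by blast
    qed
    ultimately show ?thesis by blast
  qed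
qed

end

section \<open>Supports of the brackets\<close>

text \<open>A path with two consecutive arrows forming a zero relation factors through it and lies
  in the ideal. Conversely, the combinations of paths containing such a pair form an ideal
  \<open>M\<close> that contains the generators.\<close>

lemma (in fin_digraph) nonzero_paths_iff:
  fixes I :: "(('a, 'b) qpath \<Rightarrow>\<^sub>0 'k::field) set"
  assumes q: "quadratic G I"
  shows "p \<in> nonzero_paths G I \<longleftrightarrow> p \<in> paths G \<and> successively (nonzero_rel G I) (snd p)"
proof -
  let ?K = "path_algebra G :: (('a, 'b) qpath \<Rightarrow>\<^sub>0 'k::field) ring"
  let ?N = "nonzero_rel G I"
  interpret K: ring ?K by (rule path_algebra_ring)
  interpret I: ideal I ?K by (rule quadratic_monomial(1)[OF q])
  have "basis (u, es) \<in> I" if "(u, es) \<in> paths G" "\<not> successively ?N es" for u es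
    using that
  proof (induction es arbitrary: u rule: induct_list012)
    case (3 a b es)
    then have a: "a \<in> arcs G" "tail G a = u" "tail G b = head G a" "b \<in> arcs G"
      and p: "(head G a, b # es) \<in> paths G" "(head G b, es) \<in> paths G" "(u, [a, b]) \<in> paths G" "(u, [a]) \<in> paths G"
      by (auto simp: paths_def awalk_Cons_iff awalk_Nil_iff)
    show ?case
    proof (cases "?N a b")
      case True
      then have "basis (head G a, b # es) \<in> I" using 3 p by simp
      then have "basis (u, [a]) \<otimes>\<^bsub>?K\<^esub> basis (head G a, b # es) \<in> I" using p by (intro I.I_l_closed) auto
      then show ?thesis by (simp add: concat_paths_def composable_def target_simp)
    next
      case False
      then have "basis (u, [a, b]) \<in> I" using a by (simp add: nonzero_rel_def)
      then have "basis (u, [a, b]) \<otimes>\<^bsub>?K\<^esub> basis (head G b, es) \<in> I" using p by (intro I.I_r_closed) auto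
      then show ?thesis by (simp add: concat_paths_def composable_def target_simp)
    qed
  qed auto
  moreover have "basis p \<notin> I" if "successively ?N (snd p)"
  proof -
    obtain R where R: "R \<subseteq> {p \<in> paths G. length (snd p) = 2}" "I = genideal ?K (basis ` R)"
      using q unfolding quadratic_def by blast
    have c: "basis ` R \<subseteq> carrier ?K" using R by auto
    define M where "M = {x :: ('a, 'b) qpath \<Rightarrow>\<^sub>0 'k. Poly_Mapping.keys x \<subseteq> {p \<in> paths G. \<not> successively ?N (snd p)}}"
    have "ideal M ?K"
    proof (rule idealI)
      show "ring ?K" by (rule path_algebra_ring)
      show "subgroup M (add_monoid ?K)"
      proof (rule K.add.subgroupI)
        show "M \<subseteq> carrier ?K" by (auto simp: M_def)
        show "M \<noteq> {}" by (auto simp: M_def intro!: exI[of _ 0])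
        show "a \<oplus>\<^bsub>?K\<^esub> b \<in> M" if "a \<in> M" "b \<in> M" for a b
          using that keys_add[of a b] by (auto simp: M_def)
        show "\<ominus>\<^bsub>?K\<^esub> a \<in> M" if "a \<in> M" for a
        proof -
          have "\<ominus>\<^bsub>?K\<^esub> a = - a" using that by (intro K.minus_equality) (auto simp: M_def)
          then show ?thesis using that by (simp add: M_def)
        qed
      qed
      have mult: "x \<otimes>\<^bsub>?K\<^esub> y \<in> M" if xy: "x \<in> carrier ?K" "y \<in> carrier ?K" "x \<in> M \<or> y \<in> M" for x y
      proof -
        have "r \<in> paths G \<and> \<not> successively ?N (snd r)" if "r \<in> Poly_Mapping.keys (x \<otimes>\<^bsub>?K\<^esub> y)" for r
          using that
        proof (rule path_algebra_mult_keys)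
          fix p q assume pq: "p \<in> Poly_Mapping.keys x" "q \<in> Poly_Mapping.keys y" "composable G p q"
            "r = (fst p, snd p @ snd q)"
          then have "p \<in> paths G" "q \<in> paths G" using xy by auto
          moreover have "\<not> successively ?N (snd p) \<or> \<not> successively ?N (snd q)"
            using pq xy(3) unfolding M_def by blast
          ultimately show ?thesis using paths_concat pq by (auto simp: successively_append_iff)
        qed
        then show ?thesis unfolding M_def by blast
      qed
      have "M \<subseteq> carrier ?K" by (auto simp: M_def)
      then show "x \<otimes>\<^bsub>?K\<^esub> a \<in> M" "a \<otimes>\<^bsub>?K\<^esub> x \<in> M" if "a \<in> M" "x \<in> carrier ?K" for a x
        using mult that by blast+
    qed
    moreover have "basis ` R \<subseteq> M"
    proof
      fix x :: "('a, 'b) qpath \<Rightarrow>\<^sub>0 'k" assume "x \<in> basis ` R"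
      then obtain r where r: "r \<in> R" "x = basis r" by blast
      then obtain u a b where p: "r = (u, [a, b])" "(u, [a, b]) \<in> paths G"
        using R(1) by (cases r) (auto simp: length_Suc_conv eval_nat_numeral)
      have "basis r \<in> I" using R(2) K.genideal_self[OF c] r by auto
      then have "\<not> ?N a b" using p by (auto simp: nonzero_rel_def paths_def awalk_Cons_iff)
      then show "x \<in> M" using p r by (simp add: M_def)
    qed
    ultimately have "I \<subseteq> M" using K.genideal_minimal R by blast
    then show ?thesis using that by (auto simp: M_def)
  qed
  ultimately show ?thesis by (cases p) (auto simp: nonzero_paths_def)
qed

section \<open>Coefficients and supports of products\<close>

lemma lin_swap: "lin (\<lambda>p. lin (h p) y) x = lin (\<lambda>q. lin (\<lambda>p. h p q) x) y"
  unfolding lin_def scale_sum by (subst sum.swap) (simp add: mult.commute)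

lemma lookup_lin:
  "Poly_Mapping.lookup (lin F x) q
    = (\<Sum>p\<in>Poly_Mapping.keys x. Poly_Mapping.lookup x p * Poly_Mapping.lookup (F p) q)"
  by (simp add: lin_def lookup_sum)

text \<open>Multiplication by a fixed path is injective on the paths composable with it, so the
  terms of such a product cannot cancel each other.\<close>

lemma lookup_mult_basis_left:
  "Poly_Mapping.lookup (lin (concat_paths G p) y) (fst p, snd p @ es) = Poly_Mapping.lookup y (target G p, es)"
proof -
  have "Poly_Mapping.lookup (lin (concat_paths G p) y) (fst p, snd p @ es)
      = (\<Sum>q\<in>Poly_Mapping.keys y. if q = (target G p, es) then Poly_Mapping.lookup y q else 0)"
    unfolding lookup_lin
    by (rule sum.cong) (auto simp: concat_paths_def composable_def lookup_basis)
  then show ?thesis by (simp add: in_keys_iff)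
qed

lemma lookup_mult_basis_right:
  assumes "target G (u, es) = fst q"
  shows "Poly_Mapping.lookup (lin (\<lambda>p. concat_paths G p q) x) (u, es @ snd q) = Poly_Mapping.lookup x (u, es)"
proof -
  have "Poly_Mapping.lookup (lin (\<lambda>p. concat_paths G p q) x) (u, es @ snd q)
      = (\<Sum>p\<in>Poly_Mapping.keys x. if p = (u, es) then Poly_Mapping.lookup x p else 0)"
    unfolding lookup_lin using assms
    by (intro sum.cong) (auto simp: concat_paths_def composable_def lookup_basis)
  then show ?thesis by (simp add: in_keys_iff)
qed

lemma (in fin_digraph) quiver_algebra_mult_keys:
  assumes "r \<in> Poly_Mapping.keys (x \<otimes>\<^bsub>quiver_algebra G I\<^esub> y)"
  obtains p q where "p \<in> Poly_Mapping.keys x" "q \<in> Poly_Mapping.keys y" "composable G p q"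
    "r = (fst p, snd p @ snd q)" "r \<in> nonzero_paths G I"
proof -
  have "r \<in> Poly_Mapping.keys (x \<otimes>\<^bsub>path_algebra G\<^esub> y)" "r \<in> nonzero_paths G I"
    using assms by (simp_all add: keys_normal_form)
  then show ?thesis using that by (blast elim: path_algebra_mult_keys)
qed

lemma keys_path_class: "Poly_Mapping.keys (path_class G I p) \<subseteq> {p}"
  by (auto simp: path_class_def keys_normal_form)

lemma (in fin_digraph) mult_path_class_keys:
  assumes "w \<in> Poly_Mapping.keys (x \<otimes>\<^bsub>quiver_algebra G I\<^esub> path_class G I q)"
  obtains p where "p \<in> Poly_Mapping.keys x" "snd w = snd p @ snd q" "w \<in> nonzero_paths G I"
  using assms
proof (rule quiver_algebra_mult_keys)
  fix p q' assume "q' \<in> Poly_Mapping.keys (path_class G I q)"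
  then have "q' = q" using keys_path_class by blast
  moreover assume "p \<in> Poly_Mapping.keys x" "w = (fst p, snd p @ snd q')" "w \<in> nonzero_paths G I"
  ultimately show thesis using that[of p] by simp
qed

lemma path_class_nonzero: "p \<in> nonzero_paths G I \<Longrightarrow> path_class G I p = basis p"
  unfolding path_class_def by (rule normal_form_fixes) simp

lemma keys_lin_nonzero:
  assumes "w \<in> Poly_Mapping.keys (lin F x)"
  obtains p where "p \<in> Poly_Mapping.keys x" "w \<in> Poly_Mapping.keys (F p)"
  using assms keys_lin[of F x] by blast

section \<open>Cocycles of a gentle algebra and their supports\<close>

locale acyclic_gentle_quiver = fin_digraph G + acyclic_quiver G
  for G :: "('v, 'e) pre_digraph" (structure) +
  fixes I :: "(('v, 'e) qpath \<Rightarrow>\<^sub>0 'k::field) set"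
  assumes gentle: "gentle G I"
begin

definition cocycles :: "('v, 'e, 'k) cochain set" where
  "cocycles = {f \<in> B1 G I. two_cocycle G I f}"

definition cocycle_support :: "'e \<Rightarrow> 'e \<Rightarrow> 'e list set" where
  "cocycle_support a b = {snd p | p f. f \<in> cocycles \<and> p \<in> Poly_Mapping.keys (f [a, b])}"

lemma quad: "quadratic G I"
  using gentle by (simp add: gentle_def)

lemma nonzero_iff: "p \<in> nonzero_paths G I \<longleftrightarrow> p \<in> paths G \<and> successively (nonzero_rel G I) (snd p)"
  by (rule nonzero_paths_iff[OF quad])

lemma AP2: "[a, b] \<in> AP G I 2 \<longleftrightarrow> zero_rel G I a b"
  by (auto simp: AP_def zero_rel_def less_Suc_eq)

lemma AP3: "[a, b, c] \<in> AP G I 3 \<longleftrightarrow> zero_rel G I a b \<and> zero_rel G I b c"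
  by (auto simp: AP_def zero_rel_def less_Suc_eq eval_nat_numeral)

lemma paths_awalk: "(u, es) \<in> paths G \<Longrightarrow> awalk u es (target G (u, es))"
  using awalk_target by (auto simp: paths_def)

lemma B1_keysD:
  assumes f: "f \<in> B1 G I" and p: "p \<in> Poly_Mapping.keys (f [a, b])"
  shows "zero_rel G I a b" "p \<in> nonzero_paths G I" "fst p = tail G a" "target G p = head G b"
    "awalk (tail G a) (snd p) (head G b)" "successively (nonzero_rel G I) (snd p)" "snd p \<noteq> []"
proof -
  have ap: "[a, b] \<in> AP G I 2" using f p unfolding B1_def by (metis (mono_tags, lifting) empty_iff keys_zero mem_Collect_eq)
  then show Z: "zero_rel G I a b" by (simp add: AP2)
  have k: "p \<in> {p \<in> nonzero_paths G I. parallel_paths G p (tail G a, [a, b])}"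
    using f p ap unfolding B1_def by fastforce
  then show nz: "p \<in> nonzero_paths G I" and e: "fst p = tail G a" "target G p = head G b"
    by (auto simp: parallel_paths_def target_simp)
  show w: "awalk (tail G a) (snd p) (head G b)"
    using nz e paths_awalk[of "fst p" "snd p"] by (cases p) (auto simp: nonzero_iff)
  show "successively (nonzero_rel G I) (snd p)" using nz by (simp add: nonzero_iff)
  show "snd p \<noteq> []"
  proof
    assume "snd p = []"
    then have "awalk (tail G a) [a, b] (tail G a)"
      using w Z by (auto simp: awalk_Nil_iff awalk_Cons_iff zero_rel_def)
    then show False using closed_awalk_Nil by blast
  qed
qed

lemma arrow_nonzero: "a \<in> arcs G \<Longrightarrow> arrow G a \<in> nonzero_paths G I"
  by (auto simp: nonzero_iff arrow_def paths_def intro: arc_implies_awalk)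

text \<open>A term of \<open>f [a, b]\<close> whose product with \<open>c\<close> is nonzero keeps
  its coefficient in that product. By the cocycle equation the product path also occurs in
  \<open>a\<close> times \<open>f [b, c]\<close>, so it starts with \<open>a\<close>. The second
  claim is the mirror image.\<close>

lemma delta2_keys:
  assumes f: "f \<in> B1 G I" and Z: "zero_rel G I a b" "zero_rel G I b c" and d: "delta2 G I f a b c = 0"
  shows "p \<in> Poly_Mapping.keys (f [a, b]) \<Longrightarrow> successively (nonzero_rel G I) (snd p @ [c]) \<Longrightarrow> hd (snd p) = a"
    and "q \<in> Poly_Mapping.keys (f [b, c]) \<Longrightarrow> successively (nonzero_rel G I) (a # snd q) \<Longrightarrow> last (snd q) = c"
proof -
  let ?l = "path_class G I (arrow G a) \<otimes>\<^bsub>quiver_algebra G I\<^esub> f [b, c]"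
  let ?r = "f [a, b] \<otimes>\<^bsub>quiver_algebra G I\<^esub> path_class G I (arrow G c)"
  have eq: "?l = ?r" using d by (simp add: delta2_def)
  have arcs: "a \<in> arcs G" "b \<in> arcs G" "c \<in> arcs G" "head G a = tail G b" "head G b = tail G c"
    using Z by (auto simp: zero_rel_def)
  have common: "\<exists>p'\<in>Poly_Mapping.keys (f [a, b]). \<exists>q'\<in>Poly_Mapping.keys (f [b, c]). snd r = snd p' @ [c] \<and> snd r = a # snd q'"
    if r: "r \<in> Poly_Mapping.keys ?l" for r
  proof -
    obtain q' where "q' \<in> Poly_Mapping.keys (f [b, c])" "snd r = a # snd q'"
      using quiver_algebra_mult_keys[OF r] keys_path_class[of G I "arrow G a"]
      by (metis append_Cons append_Nil arrow_def singletonD snd_conv subsetD)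
    moreover obtain p' where "p' \<in> Poly_Mapping.keys (f [a, b])" "snd r = snd p' @ [c]"
      using mult_path_class_keys[OF r[unfolded eq]] by (metis arrow_def snd_conv)
    ultimately show ?thesis by blast
  qed
  show "hd (snd p) = a"
    if p: "p \<in> Poly_Mapping.keys (f [a, b])" and N: "successively (nonzero_rel G I) (snd p @ [c])"
  proof -
    note pD = B1_keysD[OF f p]
    have "awalk (tail G a) (snd p @ [c]) (head G c)"
      using pD(5) arcs by (auto simp: awalk_Cons_iff awalk_Nil_iff)
    then have "(tail G a, snd p @ [c]) \<in> nonzero_paths G I" using N by (auto simp: nonzero_iff paths_def)
    moreover have "Poly_Mapping.lookup (lin (\<lambda>p. concat_paths G p (arrow G c)) (f [a, b])) (tail G a, snd p @ snd (arrow G c))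
        = Poly_Mapping.lookup (f [a, b]) (tail G a, snd p)"
      by (rule lookup_mult_basis_right) (use pD arcs in \<open>metis arrow_def fst_conv prod.collapse\<close>)
    moreover have "(tail G a, snd p) = p" using pD(3) by (metis prod.collapse)
    ultimately have "(tail G a, snd p @ [c]) \<in> Poly_Mapping.keys ?r"
      using p arcs by (simp add: keys_normal_form in_keys_iff path_class_nonzero arrow_nonzero)
        (simp add: arrow_def)
    then obtain q' where "snd p @ [c] = a # snd q'" using common[of "(tail G a, snd p @ [c])"] unfolding eq by auto
    then show ?thesis using pD(7) by (metis hd_append2 list.sel(1))
  qed
  show "last (snd q) = c"
    if q: "q \<in> Poly_Mapping.keys (f [b, c])" and N: "successively (nonzero_rel G I) (a # snd q)"
  proof -
    note qD = B1_keysD[OF f q]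
    have "awalk (tail G a) (a # snd q) (head G c)"
      using qD(5) arcs by (auto simp: awalk_Cons_iff)
    then have "(tail G a, a # snd q) \<in> nonzero_paths G I" using N by (auto simp: nonzero_iff paths_def)
    moreover have "Poly_Mapping.lookup (lin (concat_paths G (arrow G a)) (f [b, c])) (fst (arrow G a), snd (arrow G a) @ snd q)
        = Poly_Mapping.lookup (f [b, c]) (target G (arrow G a), snd q)"
      by (rule lookup_mult_basis_left)
    moreover have "(target G (arrow G a), snd q) = q" using qD(3) arcs by (simp add: arrow_def target_simp prod_eq_iff)
    ultimately have "(tail G a, a # snd q) \<in> Poly_Mapping.keys ?l"
      using q arcs by (simp add: keys_normal_form in_keys_iff path_class_nonzero arrow_nonzero)
        (simp add: arrow_def)
    then obtain p' where "snd p' @ [c] = a # snd q" using common[of "(tail G a, a # snd q)"] by auto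
    then show ?thesis using qD(7) by (metis last_ConsR last_snoc)
  qed
qed

sublocale gentle_rewriting G "nonzero_rel G I" "zero_rel G I" cocycle_support
proof
  fix a b c a' b' s
  show NZ: "nonzero_rel G I a b \<or> zero_rel G I a b \<longleftrightarrow> a \<in> arcs G \<and> b \<in> arcs G \<and> head G a = tail G b" for a b
    by (auto simp: nonzero_rel_def zero_rel_def)
  show disj: "nonzero_rel G I a b \<Longrightarrow> \<not> zero_rel G I a b" for a b
    by (auto simp: nonzero_rel_def zero_rel_def)
  show "nonzero_rel G I a b \<Longrightarrow> nonzero_rel G I a b' \<Longrightarrow> b = b'"
    and "nonzero_rel G I a b \<Longrightarrow> nonzero_rel G I a' b \<Longrightarrow> a = a'"
    and Z1: "\<And>a b b'. zero_rel G I a b \<Longrightarrow> zero_rel G I a b' \<Longrightarrow> b = b'"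
    and Z2: "\<And>a b a'. zero_rel G I a b \<Longrightarrow> zero_rel G I a' b \<Longrightarrow> a = a'"
    using gentle NZ unfolding gentle_def Uniq_def by metis+
  show "zero_rel G I a b" "successively (nonzero_rel G I) s" "awalk (tail G a) s (head G b)"
    if "s \<in> cocycle_support a b"
    using that B1_keysD by (auto simp: cocycle_support_def cocycles_def)
  show "hd s = a \<or> last s = b" if Z: "zero_rel G I a b" "zero_rel G I b c" and s: "s \<in> cocycle_support a b"
  proof (rule disjCI)
    obtain p f where f: "f \<in> B1 G I" "two_cocycle G I f" and p: "p \<in> Poly_Mapping.keys (f [a, b])" "s = snd p"
      using s by (auto simp: cocycle_support_def cocycles_def)
    note pD = B1_keysD[OF f(1) p(1)]
    assume "last s \<noteq> b"
    \<comment> \<open>The zero relation into \<open>c\<close> comes from \<open>b\<close> only, so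
      \<open>s\<close> continues by \<open>c\<close> to a nonzero path and
      \<open>delta2_keys\<close> applies.\<close>
    then have "\<not> zero_rel G I (last s) c" using Z2 Z(2) by blast
    moreover have "last s \<in> arcs G" "head G (last s) = head G b"
      using awalk_last[OF pD(5,7)] p(2) by simp_all
    ultimately have "nonzero_rel G I (last s) c" using Z NZ[of "last s" c] by (auto simp: zero_rel_def)
    then have "successively (nonzero_rel G I) (snd p @ [c])"
      using pD p by (auto simp: successively_append_iff)
    then show "hd s = a"
      using delta2_keys(1)[OF f(1) Z _ p(1)] f(2) Z p(2) by (auto simp: two_cocycle_def AP3)
  qed
  show "hd s = b \<or> last s = c" if Z: "zero_rel G I a b" "zero_rel G I b c" and s: "s \<in> cocycle_support b c"
  proof (subst disj_commute, rule disjCI)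
    obtain p f where f: "f \<in> B1 G I" "two_cocycle G I f" and p: "p \<in> Poly_Mapping.keys (f [b, c])" "s = snd p"
      using s by (auto simp: cocycle_support_def cocycles_def)
    note pD = B1_keysD[OF f(1) p(1)]
    assume "hd s \<noteq> b"
    then have "\<not> zero_rel G I a (hd s)" using Z1 Z(1) by blast
    moreover have "hd s \<in> arcs G" "tail G (hd s) = tail G b"
      using awalk_hd[OF pD(5,7)] p(2) by simp_all
    ultimately have "nonzero_rel G I a (hd s)" using Z NZ[of a "hd s"] by (auto simp: zero_rel_def)
    then have "successively (nonzero_rel G I) (a # snd p)"
      using pD p by (auto simp: successively_Cons)
    then show "last s = c"
      using delta2_keys(2)[OF f(1) Z _ p(1)] f(2) Z p(2) by (auto simp: two_cocycle_def AP3)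
  qed
qed

section \<open>The map \<open>phi\<close> for a single cochain, and the binary bracket\<close>

lemma tensor2_iff:
  "tensor G I [u, v] \<longleftrightarrow> u \<in> nonzero_paths G I \<and> snd u \<noteq> [] \<and> v \<in> nonzero_paths G I \<and> snd v \<noteq> [] \<and> composable G u v"
  by (auto simp: tensor_def less_Suc_eq)

lemma path_class_eq_0: "\<not> successively (nonzero_rel G I) (snd p) \<Longrightarrow> path_class G I p = 0"
  using keys_normal_form[of G I "basis p"] nonzero_iff[of p]
  by (metis Int_emptyI keys_basis keys_eq_empty path_class_def singletonD)

text \<open>\<open>normal_form G I\<close> is multiplicative, so the triple product can be formed in
  the path algebra, where the end points match by parallelism, and reduced once at the end.\<close>

lemma phi_single:
  assumes f: "f \<in> B1 G I" and t: "tensor G I [u, v]" and Z: "zero_rel G I (last (snd u)) (hd (snd v))"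
  shows "phi G I [f] u v = lin (\<lambda>s. path_class G I (fst u, butlast (snd u) @ snd s @ tl (snd v)))
    (f [last (snd u), hd (snd v)])"
proof -
  let ?K = "path_algebra G :: (('v, 'e) qpath \<Rightarrow>\<^sub>0 'k) ring"
  let ?A = "quiver_algebra G I"
  define X where "X = f [last (snd u), hd (snd v)]"
  define p where "p = (fst u, butlast (snd u))"
  define q where "q = (head G (hd (snd v)), tl (snd v))"
  note hom = normal_form_hom[OF quad]
  have uv: "u \<in> paths G" "v \<in> paths G" "snd u \<noteq> []" "snd v \<noteq> []"
    using t by (auto simp: tensor2_iff nonzero_iff)
  then have "awalk (fst u) (butlast (snd u) @ [last (snd u)]) (target G u)"
    using paths_awalk[of "fst u" "snd u"] by simp
  then have "awalk (fst u) (butlast (snd u)) (tail G (last (snd u)))" using awalk_snocD by blast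
  then have p: "p \<in> paths G" "target G p = tail G (last (snd u))"
    using awalk_target by (auto simp: paths_def p_def)
  have q: "q \<in> paths G"
    using uv by (cases "snd v"; cases v) (auto simp: paths_def q_def awalk_Cons_iff)
  have X: "s \<in> nonzero_paths G I \<and> fst s = target G p \<and> target G s = fst q" if "s \<in> Poly_Mapping.keys X" for s
    using B1_keysD[OF f that[unfolded X_def]] p by (simp add: q_def)
  then have "Poly_Mapping.keys X \<subseteq> nonzero_paths G I" by blast
  then have XA: "X = normal_form G I X" "X \<in> carrier ?K"
    by (simp_all add: normal_form_fixes nonzero_paths_def subset_iff)
  interpret K: ring ?K by (rule path_algebra_ring)
  have c: "basis p \<in> carrier ?K" "basis q \<in> carrier ?K" using p q by auto
  have "phi G I [f] u v = path_class G I p \<otimes>\<^bsub>?A\<^esub> X \<otimes>\<^bsub>?A\<^esub> path_class G I q"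
    using t Z by (subst phi.simps) (simp add: Let_def X_def p_def q_def del: quiver_algebra_simps)
  also have "\<dots> = normal_form G I (basis p) \<otimes>\<^bsub>?A\<^esub> normal_form G I X \<otimes>\<^bsub>?A\<^esub> normal_form G I (basis q)"
    by (simp only: path_class_def XA(1)[symmetric])
  also have "\<dots> = normal_form G I (basis p \<otimes>\<^bsub>?K\<^esub> X \<otimes>\<^bsub>?K\<^esub> basis q)"
    by (simp only: ring_hom_mult[OF hom c(1) XA(2)] ring_hom_mult[OF hom K.m_closed[OF c(1) XA(2)] c(2)])
  also have "basis p \<otimes>\<^bsub>?K\<^esub> X \<otimes>\<^bsub>?K\<^esub> basis q = lin (\<lambda>s. basis (fst u, butlast (snd u) @ snd s @ tl (snd v))) X"
  proof -
    have "lin (\<lambda>r. concat_paths G r q) (concat_paths G p s) = (basis (fst u, butlast (snd u) @ snd s @ tl (snd v)) :: _ \<Rightarrow>\<^sub>0 'k)"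
      if "s \<in> Poly_Mapping.keys X" for s
    proof -
      have "target G (fst p, snd p @ snd s) = fst q"
        using X[OF that] target_append[of G "fst p" "snd p" "target G p" "snd s"] by (metis prod.collapse)
      then show ?thesis using X[OF that] by (simp add: concat_paths_def composable_def p_def q_def)
    qed
    then show ?thesis by (simp add: lin_lin cong: lin_cong)
  qed
  finally show ?thesis by (simp add: normal_form_def lin_lin path_class_def X_def)
qed

lemma phi_single_eq_0:
  "\<not> zero_rel G I (last (snd u)) (hd (snd v)) \<Longrightarrow> phi G I [f] u v = 0"
  by (subst phi.simps) (simp add: Let_def)

text \<open>
  A pair \<open>p' \<alpha>\<^sub>2\<close>, \<open>\<alpha>\<^sub>2 q'\<close> in the supports of \<open>g(\<alpha>\<^sub>1\<alpha>\<^sub>2)\<close> and \<open>f(\<alpha>\<^sub>2\<alpha>\<^sub>3)\<close> yields the path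
  \<open>p' \<alpha>\<^sub>2 q'\<close> from both ends, with opposite signs; all other pairs contribute zero.
\<close>

lemma gbracket_single:
  assumes f: "f \<in> B1 G I" and g: "g \<in> B1 G I" and Z: "zero_rel G I a1 a2" "zero_rel G I a2 a3"
  shows "gbracket (phi G I [f]) (phi G I [g]) (arrow G a1) (arrow G a2) (arrow G a3) = 0"
proof -
  have arrow_phi: "phi G I [h] (arrow G a) (arrow G b) = h [a, b]" if h: "h \<in> B1 G I" and Zab: "zero_rel G I a b" for h a b
  proof -
    have t: "tensor G I [arrow G a, arrow G b]"
      using Z_D[OF Zab] by (auto simp: tensor2_iff arrow_nonzero) (auto simp: arrow_def composable_def target_simp)
    have "phi G I [h] (arrow G a) (arrow G b) = lin (\<lambda>s. path_class G I (tail G a, snd s)) (h [a, b])"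
      using phi_single[OF h t] Zab by (simp add: arrow_def)
    also have "\<dots> = lin basis (h [a, b])"
    proof (rule lin_cong)
      fix s assume "s \<in> Poly_Mapping.keys (h [a, b])"
      then show "path_class G I (tail G a, snd s) = basis s"
        using B1_keysD[OF h] path_class_nonzero by (metis prod.collapse)
    qed
    finally show ?thesis by (simp add: lin_basis_id)
  qed
  have swap: "lin (\<lambda>p. phi G I [f] p (arrow G a3)) (g [a1, a2]) = lin (\<lambda>q. phi G I [g] (arrow G a1) q) (f [a2, a3])"
    if f: "f \<in> B1 G I" and g: "g \<in> B1 G I" for f g
  proof -
    \<comment> \<open>\<open>H\<close> and \<open>H'\<close> are the contributions of a pair
      \<open>(p, q)\<close> seen from the two sides. Their conditions disagree only if exactly one
      of the two paths contains \<open>a2\<close> at its inner end.\<close>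
    define H where "H = (\<lambda>(p :: ('v, 'e) qpath) (q :: ('v, 'e) qpath). if last (snd p) = a2
      then path_class G I (fst p, butlast (snd p) @ snd q) else 0)"
    define H' where "H' = (\<lambda>(p :: ('v, 'e) qpath) (q :: ('v, 'e) qpath). if hd (snd q) = a2
      then path_class G I (tail G a1, snd p @ tl (snd q)) else 0)"
    have "phi G I [f] p (arrow G a3) = lin (H p) (f [a2, a3])" if p: "p \<in> Poly_Mapping.keys (g [a1, a2])" for p
    proof (cases "last (snd p) = a2")
      case True
      have "tensor G I [p, arrow G a3]"
        using B1_keysD[OF g p] Z_D[OF Z(2)] by (auto simp: tensor2_iff arrow_nonzero) (auto simp: arrow_def composable_def)
      then show ?thesis using phi_single[OF f, of p "arrow G a3"] True Z by (simp add: arrow_def H_def)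
    next
      case False
      then have "\<not> zero_rel G I (last (snd p)) a3" using Z_unique(2) Z(2) by blast
      then show ?thesis using phi_single_eq_0[of p "arrow G a3" f] False by (simp add: arrow_def H_def lin_def)
    qed
    then have "lin (\<lambda>p. phi G I [f] p (arrow G a3)) (g [a1, a2]) = lin (\<lambda>p. lin (H p) (f [a2, a3])) (g [a1, a2])"
      by (rule lin_cong)
    also have "\<dots> = lin (\<lambda>q. lin (\<lambda>p. H p q) (g [a1, a2])) (f [a2, a3])" by (rule lin_swap)
    also have "\<dots> = lin (\<lambda>q. phi G I [g] (arrow G a1) q) (f [a2, a3])"
    proof (rule lin_cong)
      fix q assume q: "q \<in> Poly_Mapping.keys (f [a2, a3])"
      note qD = B1_keysD[OF f q]
      have "lin (\<lambda>p. H p q) (g [a1, a2]) = lin (\<lambda>p. H' p q) (g [a1, a2])"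
      proof (rule lin_cong)
        fix p assume p: "p \<in> Poly_Mapping.keys (g [a1, a2])"
        note pD = B1_keysD[OF g p]
        obtain b q' where q': "snd q = b # q'" using qD(7) by (cases "snd q") auto
        obtain p' c where p': "snd p = p' @ [c]" using pD(7) by (metis append_butlast_last_id)
        consider "b = a2" "c = a2" | "b \<noteq> a2" "c = a2" | "b = a2" "c \<noteq> a2" | "b \<noteq> a2" "c \<noteq> a2" by blast
        then show "H p q = H' p q"
        proof cases
          \<comment> \<open>\<open>a2\<close> is the only nonzero successor of
            \<open>last p'\<close>, so \<open>p'\<close> followed by \<open>q\<close> vanishes;
            acyclicity makes \<open>p'\<close> nonempty. The next case is the mirror image.\<close>
          case 2
          have "awalk (tail G a1) p' (tail G a2)" using pD(5) p' 2 awalk_snocD by metis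
          then have "p' \<noteq> []" using no_loop[of a1] Z_D[OF Z(1)] by (auto simp: awalk_Nil_iff)
          then have "nonzero_rel G I (last p') a2" using pD(6) p' 2 by (auto simp: successively_append_iff)
          then have "\<not> nonzero_rel G I (last p') b" using N_unique(1) 2 by blast
          then have "\<not> successively (nonzero_rel G I) (p' @ b # q')"
            using \<open>p' \<noteq> []\<close> by (auto simp: successively_append_iff)
          then show ?thesis using p' q' 2 by (simp add: H_def H'_def path_class_eq_0)
        next
          case 3
          have "awalk (head G a2) q' (head G a3)" using qD(5) q' 3 by (auto simp: awalk_Cons_iff)
          then have "q' \<noteq> []" using no_loop[of a3] Z_D[OF Z(2)] by (auto simp: awalk_Nil_iff)
          then have "nonzero_rel G I a2 (hd q')" using qD(6) q' 3 by (auto simp: successively_Cons)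
          then have "\<not> nonzero_rel G I c (hd q')" using N_unique(2) 3 by blast
          then have "\<not> successively (nonzero_rel G I) (p' @ c # q')"
            using \<open>q' \<noteq> []\<close> by (auto simp: successively_append_iff successively_Cons)
          then show ?thesis using p' q' 3 by (simp add: H_def H'_def path_class_eq_0)
        qed (use p' q' pD(3) in \<open>simp_all add: H_def H'_def\<close>)
      qed
      also have "\<dots> = phi G I [g] (arrow G a1) q"
      proof (cases "hd (snd q) = a2")
        case True
        have "tensor G I [arrow G a1, q]"
          using qD Z_D[OF Z(1)] by (auto simp: tensor2_iff arrow_nonzero) (auto simp: arrow_def composable_def target_simp)
        then show ?thesis using phi_single[OF g, of "arrow G a1" q] True Z by (simp add: arrow_def H'_def)
      next
        case False
        then have "\<not> zero_rel G I a1 (hd (snd q))" using Z_unique(1) Z(1) by blast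
        then show ?thesis using phi_single_eq_0[of "arrow G a1" q g] False by (simp add: arrow_def H'_def lin_def)
      qed
      finally show "lin (\<lambda>p. H p q) (g [a1, a2]) = phi G I [g] (arrow G a1) q" .
    qed
    finally show ?thesis .
  qed
  \<comment> \<open>Used for both orders of \<open>f\<close> and \<open>g\<close>,
    \<open>swap\<close> cancels the first term of \<open>gbracket\<close> against the fourth and the
    third against the second.\<close>
  show ?thesis
    by (simp add: gbracket_def arrow_phi f g Z swap)
qed

section \<open>Supports of the higher maps and vanishing of the brackets on cocycles\<close>

lemma keys_gbracket:
  assumes "w \<in> Poly_Mapping.keys (gbracket \<phi> \<psi> a b c)"
  obtains \<phi>' \<psi>' p where "(\<phi>', \<psi>') = (\<phi>, \<psi>) \<or> (\<phi>', \<psi>') = (\<psi>, \<phi>)"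
    "p \<in> Poly_Mapping.keys (\<psi>' a b) \<and> w \<in> Poly_Mapping.keys (\<phi>' p c)
      \<or> p \<in> Poly_Mapping.keys (\<psi>' b c) \<and> w \<in> Poly_Mapping.keys (\<phi>' a p)"
proof -
  have "w \<in> Poly_Mapping.keys (lin (\<lambda>p. \<phi> p c) (\<psi> a b)) \<union> Poly_Mapping.keys (lin (\<lambda>p. \<phi> a p) (\<psi> b c))
      \<union> Poly_Mapping.keys (lin (\<lambda>p. \<psi> p c) (\<phi> a b)) \<union> Poly_Mapping.keys (lin (\<lambda>p. \<psi> a p) (\<phi> b c))"
    using assms unfolding gbracket_def by (blast dest: set_mp[OF keys_add] set_mp[OF keys_diff])
  then show ?thesis using that by (blast elim: keys_lin_nonzero)
qed

text \<open>Signs and index sets are forgotten; the sizes of the blocks suffice for counting steps.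
  By the symmetry of \<open>gbracket\<close>, \<open>fs2\<close> can always be taken as the block of
  the inner map.\<close>

lemma keys_vmap:
  assumes w: "w \<in> Poly_Mapping.keys (vmap G I fs a b c)"
  obtains fs1 fs2 p where "length fs1 > 0" "length fs2 > 0" "length fs1 + length fs2 = length fs"
    "set fs1 \<subseteq> set fs" "set fs2 \<subseteq> set fs"
    "p \<in> Poly_Mapping.keys (phi G I fs2 a b) \<and> w \<in> Poly_Mapping.keys (phi G I fs1 p c)
      \<or> p \<in> Poly_Mapping.keys (phi G I fs2 b c) \<and> w \<in> Poly_Mapping.keys (phi G I fs1 a p)"
proof -
  let ?\<S> = "{S. 0 \<in> S \<and> S \<subset> {..<length fs}}"
  let ?g = "\<lambda>S. gbracket (phi G I (nths fs S)) (phi G I (nths fs ({..<length fs} - S))) a b c"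
  have "2 \<le> length fs \<and> tensor G I [a, b, c]"
    using w by (subst (asm) vmap.simps) (auto split: if_splits)
  then have "w \<in> Poly_Mapping.keys (\<Sum>S\<in>?\<S>. scale ((-1) ^ (card S * (length fs + 1) + 1)) (?g S))"
    using w by (subst (asm) vmap.simps) auto
  then obtain S where S: "0 \<in> S" "S \<subset> {..<length fs}" "w \<in> Poly_Mapping.keys (?g S)"
    using subsetD[OF keys_sum_le] subsetD[OF keys_scale] by (metis (no_types, lifting) UN_E mem_Collect_eq)
  let ?fs1 = "nths fs S" and ?fs2 = "nths fs ({..<length fs} - S)"
  have l1: "length ?fs1 = card S"
    unfolding length_nths by (rule arg_cong[where f = card]) (use S in auto)
  have l2: "length ?fs2 = card ({..<length fs} - S)"
    unfolding length_nths by (rule arg_cong[where f = card]) auto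
  have fin: "finite S" using S finite_subset by blast
  then have "card S > 0" "card S < length fs"
    using S psubset_card_mono[of "{..<length fs}" S] by (auto simp: card_gt_0_iff)
  moreover have "card ({..<length fs} - S) = length fs - card S"
    using S fin by (subst card_Diff_subset) auto
  ultimately have l: "length ?fs1 > 0" "length ?fs2 > 0" "length ?fs1 + length ?fs2 = length fs"
    using l1 l2 by linarith+
  have sets: "set ?fs1 \<subseteq> set fs" "set ?fs2 \<subseteq> set fs" by (rule set_nths_subset)+
  obtain \<phi>' \<psi>' p where "(\<phi>', \<psi>') = (phi G I ?fs1, phi G I ?fs2) \<or> (\<phi>', \<psi>') = (phi G I ?fs2, phi G I ?fs1)"
    and p: "p \<in> Poly_Mapping.keys (\<psi>' a b) \<and> w \<in> Poly_Mapping.keys (\<phi>' p c)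
      \<or> p \<in> Poly_Mapping.keys (\<psi>' b c) \<and> w \<in> Poly_Mapping.keys (\<phi>' a p)"
    using keys_gbracket[OF S(3)] by blast
  from this(1) show ?thesis
  proof
    assume "(\<phi>', \<psi>') = (phi G I ?fs1, phi G I ?fs2)"
    then show ?thesis using that[OF l sets] p by simp
  next
    assume "(\<phi>', \<psi>') = (phi G I ?fs2, phi G I ?fs1)"
    then show ?thesis using that[OF l(2,1) _ sets(2,1)] l(3) p by (simp add: add.commute)
  qed
qed

text \<open>No arrow precedes \<open>a\<close> and none follows \<open>b\<close>, so after the one
  forced replacement nothing is left to rewrite.\<close>

lemma reduces_arrows:
  assumes "reduces (nonzero_rel G I) cocycle_support [a] [b] n w" "zero_rel G I a b"
  shows "n = 1" "w \<in> cocycle_support a b"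
proof -
  have "reduces (nonzero_rel G I) cocycle_support ([] @ [a]) (b # []) n w" using assms(1) by simp
  then obtain s k l x where s: "s \<in> cocycle_support a b"
    and k: "reduces (nonzero_rel G I) cocycle_support [] s k x"
    and l: "reduces (nonzero_rel G I) cocycle_support x [] l w" and n: "n = Suc (k + l)"
    using assms(2) by (rule reduces_ZE)
  have "successively (nonzero_rel G I) ([] @ s)" using T_path(1)[OF s] by simp
  then have "k = 0" "x = s" using reduces_N[OF k] by simp_all
  moreover have "l = 0 \<and> w = x" using l by (rule reduces_NilE) simp
  ultimately show "n = 1" "w \<in> cocycle_support a b" using s n by auto
qed

text \<open>Each summand of the recursion composes two maps for complementary blocks, and the step
  counts of the blocks add up. Compositions whose inner map is evaluated at a junction inside a
  nonzero path drop out: no step is possible there, while the block is nonempty.\<close>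

lemma keys_phi:
  assumes "set fs \<subseteq> cocycles" "w \<in> Poly_Mapping.keys (phi G I fs u v)"
  shows "reduces (nonzero_rel G I) cocycle_support (snd u) (snd v) (length fs) (snd w)"
  using assms
proof (induction fs arbitrary: u v w rule: length_induct)
  case (1 fs)
  let ?N = "nonzero_rel G I" and ?Z = "zero_rel G I"
  let ?red = "reduces (nonzero_rel G I) cocycle_support"
  define bs where "bs = snd u"
  define cs where "cs = snd v"
  have t: "tensor G I [u, v]" and ne: "fs \<noteq> []"
    using 1(3) by (subst (asm) phi.simps; auto simp: Let_def split: if_splits)+
  then have N: "successively ?N bs" "successively ?N cs" "bs \<noteq> []" "cs \<noteq> []"
    by (auto simp: tensor2_iff nonzero_iff bs_def cs_def)
  obtain bs' \<beta> where bs: "bs = bs' @ [\<beta>]" using N by (metis append_butlast_last_id)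
  obtain \<gamma> cs' where cs: "cs = \<gamma> # cs'" using N by (cases cs) auto
  show ?case
  proof (cases "length fs = 1")
    case True
    then obtain f where fs: "fs = [f]" by (auto simp: length_Suc_conv)
    then have f: "f \<in> cocycles" "f \<in> B1 G I" using 1(2) by (auto simp: cocycles_def)
    have Z: "?Z \<beta> \<gamma>"
    proof (rule ccontr)
      assume "\<not> ?Z \<beta> \<gamma>"
      then show False using 1(3) phi_single_eq_0[of u v f] by (simp add: fs bs bs_def[symmetric] cs cs_def[symmetric])
    qed
    have "w \<in> Poly_Mapping.keys (lin (\<lambda>s. path_class G I (fst u, bs' @ snd s @ cs')) (f [\<beta>, \<gamma>]))"
      using phi_single[OF f(2) t] 1(3) Z by (simp add: fs bs bs_def[symmetric] cs cs_def[symmetric])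
    then obtain s where s: "s \<in> Poly_Mapping.keys (f [\<beta>, \<gamma>])"
      and "w \<in> Poly_Mapping.keys (path_class G I (fst u, bs' @ snd s @ cs'))"
      by (rule keys_lin_nonzero)
    then have w: "snd w = bs' @ snd s @ cs'" "successively ?N (snd w)"
      using keys_path_class[of G I] by (auto simp: path_class_def keys_normal_form nonzero_iff)
    have "snd s \<in> cocycle_support \<beta> \<gamma>" using s f unfolding cocycle_support_def by blast
    moreover have "successively ?N (bs' @ snd s)" "successively ?N ((bs' @ snd s) @ cs')"
      using w by (metis append_assoc successively_append_iff)+
    then have "?red bs' (snd s) 0 (bs' @ snd s)" "?red (bs' @ snd s) cs' 0 (snd w)"
      using reduces_product w by (blast, metis append_assoc reduces_product)
    ultimately have "?red (bs' @ [\<beta>]) (\<gamma> # cs') (Suc (0 + 0)) (snd w)" by (rule reduces.Reduce)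
    then show ?thesis by (simp add: fs bs bs_def[symmetric] cs cs_def[symmetric])
  next
    case False
    then have len: "length fs \<noteq> 1" "fs \<noteq> []" using ne by auto
    have IH: "?red (snd u') (snd v') (length gs) (snd w')"
      if "w' \<in> Poly_Mapping.keys (phi G I gs u' v')" "set gs \<subseteq> set fs" "length gs < length fs" for gs u' v' w'
      using 1(1) 1(2) that by blast
    define X where "X = (if ?Z \<beta> \<gamma> \<and> 2 \<le> length bs then
        vmap G I fs (fst u, bs') (arrow G \<beta>) (arrow G \<gamma>) \<otimes>\<^bsub>quiver_algebra G I\<^esub> path_class G I (head G \<gamma>, cs') else 0)"
    define Y where "Y i = vmap G I fs u (fst v, take i cs) (arrow G (cs ! i))
        \<otimes>\<^bsub>quiver_algebra G I\<^esub> path_class G I (head G (cs ! i), drop (Suc i) cs)" for i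
    have "phi G I fs u v = X - (\<Sum>i = 1..<length cs. Y i)"
      using t len by (subst phi.simps)
        (simp add: Let_def X_def Y_def bs_def[symmetric] bs cs_def[symmetric] cs del: quiver_algebra_simps)
    then have "w \<in> Poly_Mapping.keys X \<or> w \<in> Poly_Mapping.keys (\<Sum>i = 1..<length cs. Y i)"
      using 1(3) keys_diff[of X] by auto
    then consider "w \<in> Poly_Mapping.keys X" | i where "i \<in> {1..<length cs}" "w \<in> Poly_Mapping.keys (Y i)"
      using keys_sum_le[of Y "{1..<length cs}"] by blast
    then show ?thesis
    proof cases
      case 1
      then have Z: "?Z \<beta> \<gamma>" and
        "w \<in> Poly_Mapping.keys (vmap G I fs (fst u, bs') (arrow G \<beta>) (arrow G \<gamma>)
          \<otimes>\<^bsub>quiver_algebra G I\<^esub> path_class G I (head G \<gamma>, cs'))"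
        by (auto simp: X_def simp del: quiver_algebra_simps split: if_splits)
      from this(2) obtain w1 where w1: "w1 \<in> Poly_Mapping.keys (vmap G I fs (fst u, bs') (arrow G \<beta>) (arrow G \<gamma>))"
        and w: "snd w = snd w1 @ cs'" "w \<in> nonzero_paths G I"
        by (rule mult_path_class_keys) simp
      obtain fs1 fs2 p where fs: "length fs1 > 0" "length fs2 > 0" "length fs1 + length fs2 = length fs"
        "set fs1 \<subseteq> set fs" "set fs2 \<subseteq> set fs"
        and p: "p \<in> Poly_Mapping.keys (phi G I fs2 (fst u, bs') (arrow G \<beta>)) \<and> w1 \<in> Poly_Mapping.keys (phi G I fs1 p (arrow G \<gamma>))
          \<or> p \<in> Poly_Mapping.keys (phi G I fs2 (arrow G \<beta>) (arrow G \<gamma>)) \<and> w1 \<in> Poly_Mapping.keys (phi G I fs1 (fst u, bs') p)"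
        using keys_vmap[OF w1] by metis
      have less: "length fs1 < length fs" "length fs2 < length fs" using fs(1-3) by linarith+
      from p show ?thesis
      proof
        assume "p \<in> Poly_Mapping.keys (phi G I fs2 (fst u, bs') (arrow G \<beta>)) \<and> w1 \<in> Poly_Mapping.keys (phi G I fs1 p (arrow G \<gamma>))"
        then have "?red bs' [\<beta>] (length fs2) (snd p)" using IH[of p fs2] fs less by (auto simp: arrow_def)
        then have "length fs2 = 0" using reduces_N(1) N(1) bs by blast
        then show ?thesis using fs by simp
      next
        \<comment> \<open>The inner map acts on two arrows and makes exactly one replacement, which
          becomes the \<open>Reduce\<close> step; \<open>cs'\<close> is then multiplied on without
          steps.\<close>
        assume p: "p \<in> Poly_Mapping.keys (phi G I fs2 (arrow G \<beta>) (arrow G \<gamma>)) \<and> w1 \<in> Poly_Mapping.keys (phi G I fs1 (fst u, bs') p)"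
        then have "?red [\<beta>] [\<gamma>] (length fs2) (snd p)" using IH[of p fs2] fs less by (auto simp: arrow_def)
        then have p2: "length fs2 = 1" "snd p \<in> cocycle_support \<beta> \<gamma>" using reduces_arrows Z by blast+
        have "?red bs' (snd p) (length fs1) (snd w1)" using IH[of w1 fs1 "(fst u, bs')" p] p fs less by auto
        moreover have "?red (snd w1) cs' 0 (snd w)"
          using reduces_product[of ?N "snd w1" cs'] w by (simp add: nonzero_iff)
        ultimately have "?red (bs' @ [\<beta>]) (\<gamma> # cs') (Suc (length fs1 + 0)) (snd w)"
          by (rule reduces.Reduce[where T = cocycle_support and a = \<beta> and c = \<gamma>, OF p2(2)])
        then show ?thesis using p2 fs by (simp add: bs bs_def[symmetric] cs cs_def[symmetric])
      qed
    next
      case (2 i)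
      from 2(2) obtain w1 where w1: "w1 \<in> Poly_Mapping.keys (vmap G I fs u (fst v, take i cs) (arrow G (cs ! i)))"
        and w: "snd w = snd w1 @ drop (Suc i) cs" "w \<in> nonzero_paths G I"
        unfolding Y_def by (rule mult_path_class_keys) simp
      obtain fs1 fs2 p where fs: "length fs1 > 0" "length fs2 > 0" "length fs1 + length fs2 = length fs"
        "set fs1 \<subseteq> set fs" "set fs2 \<subseteq> set fs"
        and p: "p \<in> Poly_Mapping.keys (phi G I fs2 u (fst v, take i cs)) \<and> w1 \<in> Poly_Mapping.keys (phi G I fs1 p (arrow G (cs ! i)))
          \<or> p \<in> Poly_Mapping.keys (phi G I fs2 (fst v, take i cs) (arrow G (cs ! i))) \<and> w1 \<in> Poly_Mapping.keys (phi G I fs1 u p)"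
        using keys_vmap[OF w1] by metis
      have less: "length fs1 < length fs" "length fs2 < length fs" using fs(1-3) by linarith+
      have split: "cs = take i cs @ [cs ! i] @ drop (Suc i) cs" using 2(1) by (simp add: id_take_nth_drop[symmetric])
      from p show ?thesis
      proof
        \<comment> \<open>\<open>u\<close> absorbs the first \<open>i\<close> arrows of
          \<open>v\<close>, then the next one; the remaining arrows only multiply.\<close>
        assume p: "p \<in> Poly_Mapping.keys (phi G I fs2 u (fst v, take i cs)) \<and> w1 \<in> Poly_Mapping.keys (phi G I fs1 p (arrow G (cs ! i)))"
        then have "?red bs (take i cs) (length fs2) (snd p)"
          using IH[of p fs2 u "(fst v, take i cs)"] p fs less by (simp add: bs_def)
        moreover have "?red (snd p) [cs ! i] (length fs1) (snd w1)"
          using IH[of w1 fs1 p "arrow G (cs ! i)"] p fs less by (auto simp: arrow_def)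
        moreover have "?red (snd w1) (drop (Suc i) cs) 0 (snd w)"
          using reduces_product[of ?N "snd w1" "drop (Suc i) cs"] w by (simp add: nonzero_iff)
        ultimately have "?red bs (take i cs @ [cs ! i] @ drop (Suc i) cs) (length fs2 + (length fs1 + 0)) (snd w)"
          by (intro reduces_append)
        then show ?thesis using fs split by (simp add: bs_def cs_def add.commute)
      next
        assume "p \<in> Poly_Mapping.keys (phi G I fs2 (fst v, take i cs) (arrow G (cs ! i))) \<and> w1 \<in> Poly_Mapping.keys (phi G I fs1 u p)"
        then have "?red (take i cs) [cs ! i] (length fs2) (snd p)" using IH[of p fs2] fs less by (auto simp: arrow_def)
        moreover have "successively ?N (take i cs @ [cs ! i])"
          using N(2) split by (metis append_assoc successively_append_iff)
        ultimately have "length fs2 = 0" using reduces_N(1) by blast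
        then show ?thesis using fs by simp
      qed
    qed
  qed
qed

text \<open>Two arguments admit only one partition, handled by \<open>gbracket_single\<close>. For
  more arguments, the inner map acts on two arrows and accounts for one argument, while
  \<open>reduces_left\<close> and \<open>reduces_right\<close> allow the outer map at most one
  more.\<close>

lemma vmap_cocycles:
  assumes fs: "set fs \<subseteq> cocycles" and len: "length fs \<ge> 2" and Z: "zero_rel G I a1 a2" "zero_rel G I a2 a3"
  shows "vmap G I fs (arrow G a1) (arrow G a2) (arrow G a3) = 0"
proof (cases "length fs = 2")
  case True
  have "gbracket (phi G I (nths fs S)) (phi G I (nths fs ({..<length fs} - S))) (arrow G a1) (arrow G a2) (arrow G a3) = 0"
    if "0 \<in> S" "S \<subset> {..<length fs}" for S
  proof -
    have "S = {0}" "{..<length fs} - S = {1}" using that True by (auto simp: less_2_cases_iff)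
    moreover obtain f g where "fs = [f, g]" using True by (auto simp: length_Suc_conv eval_nat_numeral)
    ultimately show ?thesis using gbracket_single Z fs by (simp add: nths_Cons cocycles_def)
  qed
  then show ?thesis by (subst vmap.simps) (simp add: sum.neutral)
next
  case False
  let ?red = "reduces (nonzero_rel G I) cocycle_support"
  have "w \<notin> Poly_Mapping.keys (vmap G I fs (arrow G a1) (arrow G a2) (arrow G a3))" for w
  proof
    assume "w \<in> Poly_Mapping.keys (vmap G I fs (arrow G a1) (arrow G a2) (arrow G a3))"
    then obtain fs1 fs2 p where l: "length fs1 > 0" "length fs2 > 0" "length fs1 + length fs2 = length fs"
      "set fs1 \<subseteq> set fs" "set fs2 \<subseteq> set fs"
      and p: "p \<in> Poly_Mapping.keys (phi G I fs2 (arrow G a1) (arrow G a2)) \<and> w \<in> Poly_Mapping.keys (phi G I fs1 p (arrow G a3))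
        \<or> p \<in> Poly_Mapping.keys (phi G I fs2 (arrow G a2) (arrow G a3)) \<and> w \<in> Poly_Mapping.keys (phi G I fs1 (arrow G a1) p)"
      by (rule keys_vmap)
    have c: "set fs1 \<subseteq> cocycles" "set fs2 \<subseteq> cocycles" using l fs by auto
    from p have "length fs1 \<le> 1 \<and> length fs2 = 1"
    proof (elim disjE conjE)
      assume p: "p \<in> Poly_Mapping.keys (phi G I fs2 (arrow G a1) (arrow G a2))" "w \<in> Poly_Mapping.keys (phi G I fs1 p (arrow G a3))"
      have "?red [a1] [a2] (length fs2) (snd p)" "?red (snd p) [a3] (length fs1) (snd w)"
        using keys_phi[OF c(2) p(1)] keys_phi[OF c(1) p(2)] by (auto simp: arrow_def)
      then show ?thesis using reduces_arrows Z reduces_left by blast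
    next
      assume p: "p \<in> Poly_Mapping.keys (phi G I fs2 (arrow G a2) (arrow G a3))" "w \<in> Poly_Mapping.keys (phi G I fs1 (arrow G a1) p)"
      have "?red [a2] [a3] (length fs2) (snd p)" "?red [a1] (snd p) (length fs1) (snd w)"
        using keys_phi[OF c(2) p(1)] keys_phi[OF c(1) p(2)] by (auto simp: arrow_def)
      then show ?thesis using reduces_arrows Z reduces_right by blast
    qed
    then show False using l len False by linarith
  qed
  then show ?thesis by (metis all_not_in_conv keys_eq_empty)
qed

lemma zero_cocycle: "(\<lambda>_. 0) \<in> cocycles"
  by (simp add: cocycles_def B1_def two_cocycle_def delta2_def normal_form_def lin_def)

end

section \<open>The Maurer-Cartan equation compared order by order with the cocycle condition\<close>

theorem theorem5p4:
  fixes G :: "('v, 'e) pre_digraph"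
    and I :: "(('v, 'e) qpath \<Rightarrow>\<^sub>0 'k::field_char_0) set"
    and f :: "nat \<Rightarrow> ('v, 'e, 'k) cochain"
    and m :: nat
  assumes "fin_digraph G"
    and "admissible G I"
    and "gentle G I"
    and "\<nexists>p. pre_digraph.cycle G p"
    and "nomulti_digraph G"
    and "\<not> star_subquiver G I"
    and "\<And>i. i \<in> {1..m} \<Longrightarrow> f i \<in> B1 G I"
    and "\<And>i. m < i \<Longrightarrow> f i = (\<lambda>_. 0)"
  shows "maurer_cartan G I f \<longleftrightarrow> (\<forall>i\<in>{1..m}. two_cocycle G I (f i))"
proof -
  interpret fin_digraph G by fact
  interpret nomulti_digraph G by fact
  interpret acyclic_gentle_quiver G I
    by unfold_locales (use assms in auto)
  define rest where "rest k a1 a2 a3 = (\<Sum>n = 2..k. \<Sum>js\<in>compositions n k.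
    scale ((-1) ^ ((n + 1) * n div 2) * (1 / fact n)) (lbracket G I (map f js) a1 a2 a3))" for k a1 a2 a3
  have mc: "maurer_cartan G I f \<longleftrightarrow> (\<forall>k\<ge>1. \<forall>a1 a2 a3. [a1, a2, a3] \<in> AP G I 3 \<longrightarrow>
      - delta2 G I (f k) a1 a2 a3 - rest k a1 a2 a3 = 0)"
    by (simp add: maurer_cartan_def rest_def)
  \<comment> \<open>Two or more positive integers with sum \<open>k\<close> are all smaller than
    \<open>k\<close>, so \<open>rest k\<close> sees only earlier coefficients and vanishes once
    these are cocycles.\<close>
  have rest: "rest k a1 a2 a3 = 0"
    if f: "\<And>i. 1 \<le> i \<Longrightarrow> i < k \<Longrightarrow> f i \<in> cocycles" and a: "[a1, a2, a3] \<in> AP G I 3" for k a1 a2 a3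
  proof -
    have "lbracket G I (map f js) a1 a2 a3 = 0" if n: "n \<in> {2..k}" and js: "js \<in> compositions n k" for n js
    proof -
      have "1 \<le> j \<and> j < k" if j: "j \<in> set js" for j
      proof -
        obtain xs ys where js_eq: "js = xs @ j # ys" using split_list[OF j] by blast
        \<comment> \<open>The parts other than \<open>j\<close> number at least one and sum to at
          least their number, which gives \<open>j < k\<close>.\<close>
        have "length l \<le> sum_list l" if "\<forall>i\<in>set l. 1 \<le> i" for l :: "nat list"
          using that by (induction l) fastforce+
        from this[of "xs @ ys"] show ?thesis using n js js_eq by (auto simp: compositions_def)
      qed
      then have "set (map f js) \<subseteq> cocycles" using f by auto
      moreover have "length (map f js) \<ge> 2" using n js by (auto simp: compositions_def)
      ultimately show ?thesis using vmap_cocycles a by (simp add: lbracket_def AP3)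
    qed
    then show ?thesis by (simp add: rest_def)
  qed
  \<comment> \<open>Beyond \<open>m\<close> the coefficients are zero cochains, so all positive
    indices can be treated alike.\<close>
  have B1: "f i \<in> B1 G I" if "1 \<le> i" for i
    using assms(7)[of i] assms(8)[of i] zero_cocycle that by (cases "i \<le> m") (auto simp: cocycles_def)
  show ?thesis
  proof
    assume MC: "maurer_cartan G I f"
    \<comment> \<open>Strong induction on the order: once the earlier coefficients are cocycles, the
      equation of order \<open>k\<close> reduces to the vanishing of \<open>delta2\<close> at
      \<open>f k\<close>.\<close>
    have "f k \<in> cocycles" if "1 \<le> k" for k
      using that
    proof (induction k rule: less_induct)
      case (less k)
      have "delta2 G I (f k) a1 a2 a3 = 0" if "[a1, a2, a3] \<in> AP G I 3" for a1 a2 a3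
      proof -
        have "rest k a1 a2 a3 = 0" by (rule rest[OF _ that]) (use less in auto)
        then show ?thesis using MC less.prems that unfolding mc by (metis diff_zero neg_equal_0_iff_equal)
      qed
      then show ?case using B1 less.prems by (simp add: cocycles_def two_cocycle_def)
    qed
    then show "\<forall>i\<in>{1..m}. two_cocycle G I (f i)" by (auto simp: cocycles_def)
  next
    assume "\<forall>i\<in>{1..m}. two_cocycle G I (f i)"
    then have c: "f i \<in> cocycles" if "1 \<le> i" for i
      using B1[OF that] assms(8)[of i] zero_cocycle that by (cases "i \<le> m") (auto simp: cocycles_def)
    then show "maurer_cartan G I f"
      unfolding mc using rest by (auto simp: cocycles_def two_cocycle_def)
  qed
qed

end
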